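(* Suppose that $F$ has characteristic zero. Let $n,l>0$ be integers and let $B=a+\varpi^{-n}\mathcal{L}^{\bot}\subset\mathfrak{g}^*$ be an admissible ball. Assume that $|a|=q^{n+l}$. Then for any distribution $\xi\in\mathcal{S}^*(\exp(\varpi^l\mathcal{L}))$ we have $$\exp^*(e_B*\xi)=\exp^*(e_B)*\exp^*(\xi).$$
   Context: $F$ is a non-Archimedean local field of characteristic zero with ring of integers $\mathcal{O}$, uniformizer $\varpi$, and $q=|\varpi|^{-1}$. $\mathbf{G}$ is a reductive algebraic group over $F$, $G=\mathbf{G}(F)$, with Lie algebra $\mathfrak{g}$. Fix an additive character $\psi$ of $F$ trivial on $\mathcal{O}$ and non-trivial on $\varpi^{-1}\mathcal{O}$. A lattice in an $F$-vector space is a free finitely generated $\mathcal{O}$-submodule of full rank. Fix a lattice $\mathcal{L}\subset\mathfrak{g}$, a compact open subgroup $K\subset G$ and an analytic diffeomorphism $\exp:\mathcal{L}\to K$ such that: (1) for any $x\in\mathcal{L}$, $\exp|_{\mathcal{O}\cdot x}$ is a group homomorphism; (2) $\frac{d}{dt}\exp(tx)|_{t=0}=x$; (3) for any $X\in\varpi^m\mathcal{L}$, $Y\in\varpi^{n}\mathcal{L}$ (with integers $m,n\ge0$), $\exp^{-1}(\exp(X)\exp(Y))-X-Y\in\varpi^{m+n}\mathcal{L}$. (Such data exist.) For a lattice $\Lambda$ in a vector space $V$, $\Lambda^\bot:=\{y\in V^*:\langle x,y\rangle\in\mathcal{O}\ \forall x\in\Lambda\}$. For $x\in\mathfrak{g}^*$,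 $|x|:=\min\{|\alpha|:\alpha\in F,\ x\in\alpha\mathcal{L}^\bot\}$. For $B=a+\Lambda\subset\mathfrak{g}^*$ with $\Lambda\supset\mathcal{L}^\bot$ a lattice, put $K_B:=\exp(\Lambda^\bot)\subset G$ and $\eta_B(\exp(x)):=\psi(\langle a,x\rangle)$ for $x\in\Lambda^\bot$ (these depend only on the set $B$). $B$ is an admissible ball if $K_B$ is a group and $\eta_B$ is a character of it; in that case $e_B:=\eta_Be_{K_B}$, where $e_{K_B}$ is the normalized Haar measure on $K_B$, viewed as a smooth compactly supported measure on $G$. Distributions on $\exp(\varpi^l\mathcal{L})$ are viewed as distributions on $K$ (and $G$) supported on $\exp(\varpi^l\mathcal{L})$. $e_B*\xi$ is the convolution on the group: $\langle e_B*\xi,\varphi\rangle=\int\langle\xi,\varphi(g\,\cdot)\rangle\,de_B(g)$; it is supported in $K$. $\exp^*$ transports measures and distributions from $K$ to $\mathcal{L}$ via the homeomorphism $\exp$: $\langle\exp^*\eta,\varphi\rangle=\langle\eta,\varphi\circ\exp^{-1}\rangle$. The convolution on the right-hand side is with respect to addition on $\mathcal{L}\subset\mathfrak{g}$. *)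

theory Defs
  imports
    "HOL-Analysis.Analysis"
    "HOL-Algebra.Algebraic_Closure_Type"
    "HOL-Algebra.Coset"
    "HOL-Library.Poly_Mapping"
    "HOL-Library.Function_Algebras"
begin

section \<open>Non-Archimedean local fields\<close>

text \<open>
  A field with a non-trivial ultrametric absolute value whose metric topology is locally compact.
  The absolute value is not normalised; \<open>q\<close> below is always \<open>inverse (absv \<pi>)\<close> for a
  uniformizer \<open>\<pi>\<close>. The characteristic is left open here: characteristic zero is
  imposed by the additional sort \<open>field_char_0\<close>.
\<close>

class nonarch_local_field = field + metric_space +
  fixes absv :: "'a \<Rightarrow> real"
  assumes absv_nonneg: "0 \<le> absv x"
    and absv_eq_0_iff: "absv x = 0 \<longleftrightarrow> x = 0"
    and absv_mult: "absv (x * y) = absv x * absv y"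
    and absv_ultrametric: "absv (x + y) \<le> max (absv x) (absv y)"
    and absv_nontrivial: "\<exists>x. x \<noteq> 0 \<and> absv x \<noteq> 1"
    and dist_absv: "dist x y = absv (x - y)"
    and locally_compact: "\<exists>U C. open U \<and> 0 \<in> U \<and> U \<subseteq> C \<and> compact C"

definition val_ring :: "'f::nonarch_local_field set" where
  "val_ring = {x. absv x \<le> 1}"

definition uniformizer :: "'f::nonarch_local_field \<Rightarrow> bool" where
  "uniformizer \<pi> \<longleftrightarrow> \<pi> \<noteq> 0 \<and> {x. absv x < 1} = (\<lambda>y. \<pi> * y) ` val_ring"

definition additive_character :: "('f::nonarch_local_field \<Rightarrow> complex) \<Rightarrow> bool" where
  "additive_character \<psi> \<longleftrightarrow>
     continuous_on UNIV \<psi> \<and> (\<forall>x. cmod (\<psi> x) = 1) \<and> (\<forall>x y. \<psi> (x + y) = \<psi> x * \<psi> y)"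


section \<open>Reductive groups over a field\<close>

text \<open>
  An affine algebraic group over a field \<open>F\<close> of characteristic zero is given by a set \<open>P\<close> of
  polynomials over \<open>F\<close> in the \<open>N \<times> N\<close> matrix entries whose zeros in \<open>GL\<^sub>N\<close> of the
  algebraic closure form a subgroup. Equations involving the inverse determinant define no
  further closed subsets, since denominators can be cleared.
\<close>

type_synonym ('f, 'n) mat_poly = "('n \<times> 'n \<Rightarrow>\<^sub>0 nat) \<Rightarrow>\<^sub>0 'f"

definition mp_eval ::
  "('f::zero \<Rightarrow> 'r::comm_ring_1) \<Rightarrow> ('f, 'n::finite) mat_poly \<Rightarrow> 'r^'n^'n \<Rightarrow> 'r" where
  "mp_eval \<iota> p A =
     (\<Sum>m\<in>Poly_Mapping.keys p.
        \<iota> (Poly_Mapping.lookup p m) * (\<Prod>(i, j)\<in>UNIV. (A $ i $ j) ^ Poly_Mapping.lookup m (i, j)))"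

definition GL :: "('k::field^'n^'n) monoid" where
  "GL = \<lparr>carrier = {A. invertible A}, mult = (**), one = mat 1\<rparr>"

definition group_points ::
  "('f::zero \<Rightarrow> 'k::field) \<Rightarrow> ('f, 'n::finite) mat_poly set \<Rightarrow> ('k^'n^'n) set" where
  "group_points \<iota> P = {A. invertible A \<and> (\<forall>p\<in>P. mp_eval \<iota> p A = 0)}"

abbreviation geometric_points ::
  "('f::field, 'n::finite) mat_poly set \<Rightarrow> ('f alg_closure^'n^'n) set" where
  "geometric_points P \<equiv> group_points to_ac P"

abbreviation rational_points ::
  "('f::field, 'n::finite) mat_poly set \<Rightarrow> ('f^'n^'n) set" where
  "rational_points P \<equiv> group_points id P"

definition algebraic_group :: "('f::field, 'n::finite) mat_poly set \<Rightarrow> bool" where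
  "algebraic_group P \<longleftrightarrow> subgroup (geometric_points P) GL"

definition zariski_closed :: "('k::field^'n::finite^'n) set \<Rightarrow> bool" where
  "zariski_closed S \<longleftrightarrow> (\<exists>P :: ('k, 'n) mat_poly set. S = group_points id P)"

definition zariski_connected :: "('k::field^'n::finite^'n) set \<Rightarrow> bool" where
  "zariski_connected S \<longleftrightarrow>
     \<not> (\<exists>C D. zariski_closed C \<and> zariski_closed D \<and> S \<subseteq> C \<union> D \<and> C \<inter> D \<inter> S = {} \<and>
             C \<inter> S \<noteq> {} \<and> D \<inter> S \<noteq> {})"

definition unipotent :: "'k::field^'n::finite^'n \<Rightarrow> bool" where
  "unipotent u \<longleftrightarrow> (\<exists>k. (((**) (u - mat 1)) ^^ k) (mat 1) = 0)"

text \<open>Triviality of the unipotent radical; connectedness of the group is not required.\<close>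

definition reductive_group :: "('f::field, 'n::finite) mat_poly set \<Rightarrow> bool" where
  "reductive_group P \<longleftrightarrow> algebraic_group P \<and>
     (\<forall>U. zariski_closed U \<and> zariski_connected U \<and>
          U \<lhd> (GL\<lparr>carrier := geometric_points P\<rparr>) \<and> (\<forall>u\<in>U. unipotent u) \<longrightarrow> U = {mat 1})"

text \<open>
  The tangent space at the identity, as a space of matrices: \<open>x\<close> such that the derivative at the
  identity in direction \<open>x\<close>, i.e. the linear coefficient of \<open>p (1 + t x) \<in> F[t]\<close>, vanishes for
  every \<open>p\<close> over \<open>F\<close> in the vanishing ideal of the group. (\<open>P\<close> itself need not generate that ideal.)
\<close>

definition lie_algebra :: "('f::field, 'n::finite) mat_poly set \<Rightarrow> ('f^'n^'n) set" where
  "lie_algebra P =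
     {x. \<forall>p :: ('f, 'n) mat_poly. (\<forall>A\<in>geometric_points P. mp_eval to_ac p A = 0) \<longrightarrow>
           Polynomial.coeff
             (mp_eval (\<lambda>c. [:c:]) p (\<chi> i j. [:(mat 1 :: 'f^'n^'n) $ i $ j, x $ i $ j:])) 1 = 0}"


section \<open>Lattices and duals\<close>

definition mscale :: "'f::field \<Rightarrow> 'f^'n^'n \<Rightarrow> 'f^'n^'n" where
  "mscale c A = (\<chi> i j. c * A $ i $ j)"

definition fscale :: "'f::field \<Rightarrow> ('v \<Rightarrow> 'f) \<Rightarrow> 'v \<Rightarrow> 'f" where
  "fscale c y = (\<lambda>x. c * y x)"

text \<open>
  A basis of a free \<open>O\<close>-submodule is linearly independent over the fraction field, so a lattice in
  \<open>V\<close> is the \<open>O\<close>-span of an \<open>F\<close>-basis of \<open>V\<close>.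
\<close>

definition is_lattice ::
  "('f::nonarch_local_field \<Rightarrow> 'v::ab_group_add \<Rightarrow> 'v) \<Rightarrow> 'v set \<Rightarrow> 'v set \<Rightarrow> bool" where
  "is_lattice smul V \<Lambda> \<longleftrightarrow>
     (\<exists>E. finite E \<and> \<not> module.dependent smul E \<and> module.span smul E = V \<and>
          \<Lambda> = {\<Sum>e\<in>E. smul (c e) e | c. \<forall>e\<in>E. c e \<in> val_ring})"

text \<open>
  Linear functionals on a subspace \<open>V\<close> of the matrices are represented by functions vanishing
  outside \<open>V\<close>; then the pointwise operations on functions are the operations of the dual space.
\<close>

definition dual_space :: "('f::field^'n::finite^'n) set \<Rightarrow> ('f^'n^'n \<Rightarrow> 'f) set" where
  "dual_space V = {y. (\<forall>x. x \<notin> V \<longrightarrow> y x = 0) \<and>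
     (\<forall>x\<in>V. \<forall>x'\<in>V. y (x + x') = y x + y x') \<and> (\<forall>c. \<forall>x\<in>V. y (mscale c x) = c * y x)}"

definition dual_lattice ::
  "('f::nonarch_local_field^'n::finite^'n) set \<Rightarrow> ('f^'n^'n) set \<Rightarrow> ('f^'n^'n \<Rightarrow> 'f) set" where
  "dual_lattice V \<Lambda> = {y \<in> dual_space V. \<forall>x\<in>\<Lambda>. y x \<in> val_ring}"

text \<open>For \<open>\<Lambda>\<close> in the dual space, with the bidual of \<open>V\<close> identified with \<open>V\<close>.\<close>

definition predual_lattice ::
  "('f::nonarch_local_field^'n::finite^'n) set \<Rightarrow> ('f^'n^'n \<Rightarrow> 'f) set \<Rightarrow> ('f^'n^'n) set" where
  "predual_lattice V \<Lambda> = {x \<in> V. \<forall>y\<in>\<Lambda>. y x \<in> val_ring}"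

definition dual_abs ::
  "('f::nonarch_local_field^'n::finite^'n) set \<Rightarrow> ('f^'n^'n) set \<Rightarrow> ('f^'n^'n \<Rightarrow> 'f) \<Rightarrow> real" where
  "dual_abs V L y = (LEAST r. \<exists>\<alpha>. r = absv \<alpha> \<and> y \<in> fscale \<alpha> ` dual_lattice V L)"


section \<open>Exponential data\<close>

text \<open>
  Local analyticity for maps between arbitrary subsets of matrix space: near each point the map
  agrees with an ambient convergent power series in the matrix entries. On an open subset of a
  linear subspace or of the \<open>F\<close>-points of an algebraic group in characteristic zero (a closed
  analytic submanifold of \<open>GL\<^sub>N(F)\<close>) this is the intrinsic notion of an analytic map.
\<close>

definition analytic_map_on ::
  "('f::nonarch_local_field^'n::finite^'n) set \<Rightarrow> ('f^'n^'n \<Rightarrow> 'f^'n^'n) \<Rightarrow> bool" where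
  "analytic_map_on S f \<longleftrightarrow>
     (\<forall>p\<in>S. \<exists>(c :: ('n \<times> 'n \<Rightarrow> nat) \<Rightarrow> 'f^'n^'n) F. \<exists>r>0.
        \<forall>h. (\<forall>i j. absv (h $ i $ j) < r) \<longrightarrow>
            ((\<lambda>e. mscale (\<Prod>(i, j)\<in>UNIV. (h $ i $ j) ^ e (i, j)) (c e)) has_sum F h) UNIV \<and>
            (p + h \<in> S \<longrightarrow> f (p + h) = F h))"

definition analytic_diffeomorphism ::
  "('f::nonarch_local_field^'n::finite^'n) set \<Rightarrow> ('f^'n^'n) set \<Rightarrow> ('f^'n^'n \<Rightarrow> 'f^'n^'n) \<Rightarrow> bool"
  where
  "analytic_diffeomorphism S T f \<longleftrightarrow>
     bij_betw f S T \<and> analytic_map_on S f \<and> analytic_map_on T (inv_into S f)"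

definition exp_datum ::
  "('f::nonarch_local_field, 'n::finite) mat_poly set \<Rightarrow> 'f \<Rightarrow>
   ('f^'n^'n) set \<Rightarrow> ('f^'n^'n) set \<Rightarrow> ('f^'n^'n \<Rightarrow> 'f^'n^'n) \<Rightarrow> bool" where
  "exp_datum P \<pi> L K ex \<longleftrightarrow>
     is_lattice mscale (lie_algebra P) L \<and>
     subgroup K GL \<and> K \<subseteq> rational_points P \<and>
     compact K \<and> openin (top_of_set (rational_points P)) K \<and>
     analytic_diffeomorphism L K ex \<and>
     (\<forall>x\<in>L. \<forall>s\<in>val_ring. \<forall>t\<in>val_ring.
        ex (mscale s x + mscale t x) = ex (mscale s x) ** ex (mscale t x)) \<and>
     (\<forall>x\<in>L. ((\<lambda>t. mscale (inverse t) (ex (mscale t x) - mat 1)) \<longlongrightarrow> x) (at 0)) \<and>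
     (\<forall>(m::nat) (n::nat). \<forall>x\<in>mscale (\<pi> ^ m) ` L. \<forall>y\<in>mscale (\<pi> ^ n) ` L.
        inv_into L ex (ex x ** ex y) - x - y \<in> mscale (\<pi> ^ (m + n)) ` L)"


section \<open>Admissible balls\<close>

text \<open>
  A ball \<open>B = a + \<Lambda>\<close> is treated as a set: \<open>\<Lambda>\<close> is recovered as the set of differences, and
  any element of \<open>B\<close> may serve as centre.
\<close>

definition ball_lattice :: "('v \<Rightarrow> 'f::field) set \<Rightarrow> ('v \<Rightarrow> 'f) set" where
  "ball_lattice B = {y - z | y z. y \<in> B \<and> z \<in> B}"

definition ball_group ::
  "('f::nonarch_local_field^'n::finite^'n) set \<Rightarrow> ('f^'n^'n \<Rightarrow> 'f^'n^'n) \<Rightarrow>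
   ('f^'n^'n \<Rightarrow> 'f) set \<Rightarrow> ('f^'n^'n) set" where
  "ball_group V ex B = ex ` predual_lattice V (ball_lattice B)"

definition ball_char ::
  "('f::nonarch_local_field \<Rightarrow> complex) \<Rightarrow> ('f^'n::finite^'n) set \<Rightarrow> ('f^'n^'n \<Rightarrow> 'f^'n^'n) \<Rightarrow>
   ('f^'n^'n \<Rightarrow> 'f) set \<Rightarrow> 'f^'n^'n \<Rightarrow> complex" where
  "ball_char \<psi> L ex B g = \<psi> ((SOME a. a \<in> B) (inv_into L ex g))"

definition character_on ::
  "('f::nonarch_local_field^'n::finite^'n) set \<Rightarrow> ('f^'n^'n \<Rightarrow> complex) \<Rightarrow> bool" where
  "character_on H \<eta> \<longleftrightarrow>
     continuous_on H \<eta> \<and> (\<forall>g\<in>H. cmod (\<eta> g) = 1) \<and> (\<forall>g\<in>H. \<forall>h\<in>H. \<eta> (g ** h) = \<eta> g * \<eta> h)"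

definition admissible_ball ::
  "('f::nonarch_local_field \<Rightarrow> complex) \<Rightarrow> ('f^'n::finite^'n) set \<Rightarrow> ('f^'n^'n) set \<Rightarrow>
   ('f^'n^'n \<Rightarrow> 'f^'n^'n) \<Rightarrow> ('f^'n^'n \<Rightarrow> 'f) set \<Rightarrow> bool" where
  "admissible_ball \<psi> V L ex B \<longleftrightarrow>
     (\<exists>a \<Lambda>. a \<in> dual_space V \<and> is_lattice fscale (dual_space V) \<Lambda> \<and> dual_lattice V L \<subseteq> \<Lambda> \<and>
            B = (\<lambda>y. a + y) ` \<Lambda>) \<and>
     subgroup (ball_group V ex B) GL \<and>
     character_on (ball_group V ex B) (ball_char \<psi> L ex B)"


section \<open>Measures and distributions\<close>

definition normalized_haar ::
  "('f::nonarch_local_field^'n::finite^'n) set \<Rightarrow> ('f^'n^'n) measure \<Rightarrow> bool" where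
  "normalized_haar H M \<longleftrightarrow>
     sets M = sets (restrict_space borel H) \<and> emeasure M H = 1 \<and>
     (\<forall>g\<in>H. \<forall>A\<in>sets M. emeasure M ((\<lambda>h. g ** h) ` A) = emeasure M A)"

text \<open>
  Locally constant compactly supported functions on \<open>S\<close>, extended by zero outside \<open>S\<close>.
\<close>

definition test_functions :: "'x::topological_space set \<Rightarrow> ('x \<Rightarrow> complex) set" where
  "test_functions S =
     {\<phi>. (\<forall>x\<in>S. \<exists>U. open U \<and> x \<in> U \<and> (\<forall>y\<in>U \<inter> S. \<phi> y = \<phi> x)) \<and>
         (\<exists>C. compact C \<and> C \<subseteq> S \<and> (\<forall>x. x \<notin> C \<longrightarrow> \<phi> x = 0))}"

text \<open>
  Distributions are total functionals of which only the values on test functions matter. In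
  particular, two of them are equal on \<open>S\<close> if they agree on \<open>test_functions S\<close>.
\<close>

definition distributions :: "'x::topological_space set \<Rightarrow> (('x \<Rightarrow> complex) \<Rightarrow> complex) set" where
  "distributions S =
     {\<xi>. (\<forall>\<phi>\<in>test_functions S. \<forall>\<theta>\<in>test_functions S. \<xi> (\<lambda>x. \<phi> x + \<theta> x) = \<xi> \<phi> + \<xi> \<theta>) \<and>
         (\<forall>c. \<forall>\<phi>\<in>test_functions S. \<xi> (\<lambda>x. c * \<phi> x) = c * \<xi> \<phi>)}"

definition cut_off :: "'x set \<Rightarrow> ('x \<Rightarrow> complex) \<Rightarrow> 'x \<Rightarrow> complex" where
  "cut_off A \<phi> = (\<lambda>x. if x \<in> A then \<phi> x else 0)"

text \<open>A distribution on \<open>A\<close> viewed as a distribution, supported on \<open>A\<close>, on a larger space.\<close>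

definition extend_distribution ::
  "'x set \<Rightarrow> (('x \<Rightarrow> complex) \<Rightarrow> complex) \<Rightarrow> ('x \<Rightarrow> complex) \<Rightarrow> complex" where
  "extend_distribution A \<xi> = (\<lambda>\<phi>. \<xi> (cut_off A \<phi>))"

text \<open>
  The measure \<open>e\<^sub>B\<close> as a functional on functions, where \<open>M\<close> is the normalised Haar measure on the
  group of the ball.
\<close>

definition ball_measure ::
  "('f::nonarch_local_field \<Rightarrow> complex) \<Rightarrow> ('f^'n::finite^'n) set \<Rightarrow> ('f^'n^'n \<Rightarrow> 'f^'n^'n) \<Rightarrow>
   ('f^'n^'n) measure \<Rightarrow> ('f^'n^'n \<Rightarrow> 'f) set \<Rightarrow> ('f^'n^'n \<Rightarrow> complex) \<Rightarrow> complex" where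
  "ball_measure \<psi> L ex M B = (\<lambda>\<phi>. \<integral>g. ball_char \<psi> L ex B g * \<phi> g \<partial>M)"

definition convolution ::
  "('x \<Rightarrow> 'x \<Rightarrow> 'x) \<Rightarrow> (('x \<Rightarrow> complex) \<Rightarrow> complex) \<Rightarrow> (('x \<Rightarrow> complex) \<Rightarrow> complex) \<Rightarrow>
   ('x \<Rightarrow> complex) \<Rightarrow> complex" where
  "convolution mul e \<xi> = (\<lambda>\<phi>. e (\<lambda>g. \<xi> (\<lambda>h. \<phi> (mul g h))))"

text \<open>\<open>exp\<^sup>*\<close>; a test function on \<open>K\<close> is passed to a functional on the whole group as its extension by zero.\<close>

definition exp_transport ::
  "'x set \<Rightarrow> 'y set \<Rightarrow> ('x \<Rightarrow> 'y) \<Rightarrow> (('y \<Rightarrow> complex) \<Rightarrow> complex) \<Rightarrow> ('x \<Rightarrow> complex) \<Rightarrow> complex" where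
  "exp_transport L K ex \<xi> = (\<lambda>\<phi>. \<xi> (cut_off K (\<lambda>g. \<phi> (inv_into L ex g))))"

end

theory Submission
  imports Defs
begin

text \<open>
  Transport everything to \<open>L\<close> and write \<open>x \<star> y\<close> for the group law there, so that
  \<open>x \<star> y - x - y\<close> lies in \<open>\<pi>\<^sup>n\<^sup>+\<^sup>l L\<close> for \<open>x \<in> \<pi>\<^sup>n L\<close> and \<open>y \<in> \<pi>\<^sup>l L\<close>. A test function is invariant under
  some \<open>\<pi>\<^sup>m L\<close>, hence convolution with \<open>e\<^sub>B\<close> is a finite average over \<open>\<pi>\<^sup>n L / \<pi>\<^sup>m L\<close>, on either side of
  the identity: the left cosets of \<open>exp (\<pi>\<^sup>m L)\<close> in \<open>exp (\<pi>\<^sup>n L)\<close> are the images of the additive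
  cosets. For fixed \<open>y\<close> the substitution \<open>x \<mapsto> x \<star> y - y\<close> permutes these cosets and takes the summand
  of the additive convolution to that of the group convolution: it changes \<open>x\<close> only by an element of
  \<open>\<pi>\<^sup>n\<^sup>+\<^sup>l L\<close>, on which \<open>\<psi> \<circ> a\<close> is trivial because \<open>|a| = q\<^sup>n\<^sup>+\<^sup>l\<close>.
\<close>

text \<open>The obstacle is non-commutativity: \<open>x \<mapsto> x \<star> y - y\<close> acts on
  cosets only if right translation by \<open>y\<close> respects the left cosets of \<open>ex\<close>
  applied to \<open>lat m\<close>. It does, because elements of positive depth normalise each of
  these subgroups: for a factor of positive depth the error in \<open>star_approx\<close> is
  strictly deeper than the other factor, so depth can be gained step by step. This is where
  \<open>n > 0\<close> and \<open>l > 0\<close> enter. The level \<open>m\<close> has to satisfy two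
  demands: the test function is invariant at that level, and \<open>n + l \<le> m\<close>, so that
  replacing a point by its coset representative does not change the value of the character. The mass
  of a coset is never computed; the same factor stands on both sides. The distribution enters
  through its linearity on finite sums of test functions, which reduces the claim to an identity of
  finite sums for each single \<open>y\<close>.\<close>

no_notation fps_nth (infixl \<open>$\<close> 75)

section \<open>Non-Archimedean fields and matrix spaces\<close>

declare absv_nonneg [simp] absv_eq_0_iff [simp]

lemma absv_zero [simp]: "absv (0 :: 'a::nonarch_local_field) = 0"
  by (simp add: absv_eq_0_iff)

lemma absv_one [simp]: "absv (1 :: 'a::nonarch_local_field) = 1"
  using absv_mult[of 1 "1 :: 'a"] absv_eq_0_iff[of "1 :: 'a"] by simp

lemma absv_pos_iff [simp]: "0 < absv x \<longleftrightarrow> x \<noteq> 0"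
  using absv_nonneg[of x] absv_eq_0_iff[of x] by linarith

lemma absv_minus [simp]: "absv (- x) = absv (x :: 'a::nonarch_local_field)"
proof -
  have "absv (- 1 :: 'a) * absv (- 1 :: 'a) = 1"
    using absv_mult[of "- 1 :: 'a" "- 1"] by simp
  then have "absv (- 1 :: 'a) = 1"
    using absv_nonneg[of "- 1 :: 'a"] by (simp add: square_eq_1_iff)
  then show ?thesis
    using absv_mult[of "- 1" x] by simp
qed

lemma absv_diff_le: "absv (x - y) \<le> max (absv x) (absv y)"
  using absv_ultrametric[of x "- y"] by simp

lemma absv_inverse: "x \<noteq> 0 \<Longrightarrow> absv (inverse x) = inverse (absv x)"
  using absv_mult[of x "inverse x"] inverse_unique[of "absv x" "absv (inverse x)"] by simp

lemma absv_power: "absv (x ^ k) = absv x ^ k"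
  by (induction k) (simp_all add: absv_mult)

lemma absv_prod: "absv (\<Prod>i\<in>A. f i) = (\<Prod>i\<in>A. absv (f i))"
  by (induction A rule: infinite_finite_induct) (simp_all add: absv_mult)

lemma absv_sum_le:
  assumes "\<And>i. i \<in> A \<Longrightarrow> absv (f i) \<le> C" "0 \<le> C"
  shows "absv (\<Sum>i\<in>A. f i) \<le> C"
  using assms(1)
proof (induction A rule: infinite_finite_induct)
  case (insert x F)
  then have "max (absv (f x)) (absv (\<Sum>i\<in>F. f i)) \<le> C"
    by simp
  then show ?case
    using insert.hyps order_trans[OF absv_ultrametric] by simp
qed (use assms(2) in auto)

lemma zero_in_val_ring [simp]: "0 \<in> val_ring"
  and one_in_val_ring [simp]: "1 \<in> val_ring"
  by (simp_all add: val_ring_def)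

lemma val_ring_closed:
  assumes "x \<in> val_ring" "y \<in> val_ring"
  shows "x + y \<in> val_ring" "x - y \<in> val_ring" "x * y \<in> val_ring" "- x \<in> val_ring" "x ^ k \<in> val_ring"
proof -
  show "x + y \<in> val_ring"
    using assms absv_ultrametric[of x y] by (auto simp: val_ring_def)
  show "x - y \<in> val_ring"
    using assms absv_diff_le[of x y] by (auto simp: val_ring_def)
  show "x * y \<in> val_ring"
    using assms by (auto simp: val_ring_def absv_mult absv_nonneg mult_le_one)
  show "- x \<in> val_ring"
    using assms by (auto simp: val_ring_def)
  show "x ^ k \<in> val_ring"
    using assms by (auto simp: val_ring_def absv_power absv_nonneg power_le_one)
qed

lemma uniformizerD:
  assumes "uniformizer (\<pi> :: 'f::nonarch_local_field)"
  shows "\<pi> \<noteq> 0" "0 < absv \<pi>" "absv \<pi> < 1" "\<pi> ^ k \<in> val_ring"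
proof -
  show "\<pi> \<noteq> 0"
    using assms by (simp add: uniformizer_def)
  then show "0 < absv \<pi>"
    by simp
  have "\<pi> * 1 \<in> (\<lambda>y. \<pi> * y) ` val_ring"
    by (rule imageI) simp
  then show "absv \<pi> < 1"
    using assms by (auto simp: uniformizer_def)
  then show "\<pi> ^ k \<in> val_ring"
    using absv_nonneg[of \<pi>] by (simp add: val_ring_def absv_power power_le_one)
qed

lemma absv_power_small:
  assumes "absv (c :: 'f::nonarch_local_field) < 1" "0 < e"
  obtains k where "absv (c ^ k) < e"
  using real_arch_pow_inv[OF assms(2) assms(1)] by (auto simp: absv_power)

lemma continuous_on_mult_left_val:
  "continuous_on S (\<lambda>x :: 'f::nonarch_local_field. c * x)"
proof (rule continuous_on_iff[THEN iffD2], intro ballI allI impI)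
  fix x :: 'f and e :: real
  assume e: "0 < e"
  \<comment> \<open>The summand 1 keeps the denominator of the radius positive when
    \<open>c = 0\<close>.\<close>
  have pos: "0 < absv c + 1"
    using absv_nonneg[of c] by linarith
  show "\<exists>d>0. \<forall>x'\<in>S. dist x' x < d \<longrightarrow> dist (c * x') (c * x) < e"
  proof (intro exI[of _ "e / (absv c + 1)"] conjI ballI impI)
    show "0 < e / (absv c + 1)"
      using e pos by simp
    fix x' assume "dist x' x < e / (absv c + 1)"
    then have "(absv c + 1) * absv (x' - x) < e"
      using pos by (simp add: dist_absv pos_less_divide_eq mult.commute)
    moreover have "absv (c * x' - c * x) = absv c * absv (x' - x)"
      by (simp add: absv_mult flip: right_diff_distrib)
    ultimately show "dist (c * x') (c * x) < e"
      by (simp add: dist_absv distrib_right) (smt (verit) absv_nonneg)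
  qed
qed

text \<open>A nonzero element whose absolute value is not 1 or its inverse has absolute value below
  1, and powers of it become arbitrarily small.\<close>

lemma absv_less_pos_exists:
  assumes "0 < r"
  obtains t :: "'f::nonarch_local_field" where "t \<noteq> 0" "absv t < r"
proof -
  obtain x :: 'f where x: "x \<noteq> 0" "absv x \<noteq> 1"
    using absv_nontrivial by blast
  obtain c :: 'f where c: "c \<noteq> 0" "absv c < 1"
  proof (cases "absv x < 1")
    case True
    then show ?thesis by (rule that[OF x(1)])
  next
    case False
    then have "1 < absv x"
      using x(2) by linarith
    then have "absv (inverse x) < 1"
      unfolding absv_inverse[OF x(1)] by (rule inverse_less_1_iff[THEN iffD2, OF disjI2])
    then show ?thesis
      by (intro that[of "inverse x"]) (use x(1) in simp_all)
  qed
  obtain k where "absv (c ^ k) < r"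
    using absv_power_small[OF c(2) assms] .
  then show thesis
    by (intro that[of "c ^ k"]) (use c in simp_all)
qed

text \<open>Local compactness gives a compact neighbourhood of 0. A closed ball of radius
  \<open>absv c\<close> fits inside it, and division by \<open>c\<close> turns this ball into the
  whole ring.\<close>

lemma compact_val_ring: "compact (val_ring :: 'f::nonarch_local_field set)"
proof -
  obtain U C where UC: "open (U :: 'f set)" "0 \<in> U" "U \<subseteq> C" "compact C"
    using locally_compact by blast
  obtain e where e: "e > 0" "ball 0 e \<subseteq> U"
    using openE[OF UC(1,2)] by blast
  obtain c :: 'f where c: "c \<noteq> 0" and k: "absv c < e"
    using absv_less_pos_exists[OF e(1)] .
  have "cball 0 (absv c) \<subseteq> C"
  proof
    fix x :: 'f assume "x \<in> cball 0 (absv c)"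
    then have "x \<in> ball 0 e"
      using k by simp
    then show "x \<in> C"
      using e(2) UC(3) by blast
  qed
  then have "compact (cball (0::'f) (absv c))"
    using compact_Int_closed[OF UC(4) closed_cball] by (metis Int_absorb1)
  then have "compact ((\<lambda>x. inverse c * x) ` cball (0::'f) (absv c))"
    by (intro compact_continuous_image continuous_on_mult_left_val)
  moreover have "(\<lambda>x. inverse c * x) ` cball (0::'f) (absv c) = val_ring"
  proof (intro equalityI subsetI)
    fix x assume "x \<in> (\<lambda>x. inverse c * x) ` cball (0::'f) (absv c)"
    then obtain y where "y \<in> cball 0 (absv c)" and y1: "x = inverse c * y"
      by blast
    then have y: "x = inverse c * y" "absv y \<le> absv c"
      by (simp_all add: dist_absv)
    have "absv x = inverse (absv c) * absv y"
      using c by (simp add: y(1) absv_mult absv_inverse)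
    also have "\<dots> \<le> inverse (absv c) * absv c"
      using y(2) by (intro mult_left_mono) (auto simp: absv_nonneg)
    also have "\<dots> = 1"
      using c by (intro left_inverse) (simp add: absv_eq_0_iff)
    finally show "x \<in> val_ring"
      by (simp add: val_ring_def)
  next
    fix x :: 'f assume "x \<in> val_ring"
    then have "absv (c * x) \<le> absv c"
      using absv_nonneg[of "c"] by (simp add: val_ring_def absv_mult mult_left_le)
    then have "c * x \<in> cball 0 (absv c)"
      by (simp add: dist_absv)
    moreover have "x = inverse c * (c * x)"
      using c by simp
    ultimately show "x \<in> (\<lambda>x. inverse c * x) ` cball (0::'f) (absv c)"
      by blast
  qed
  ultimately show ?thesis
    by simp
qed

text \<open>Total boundedness at radius \<open>absv c\<close>: points closer than that differ by
  \<open>c\<close> times an integral element.\<close>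

lemma finite_residues:
  assumes "(c :: 'f::nonarch_local_field) \<noteq> 0"
  obtains D where "finite D" "D \<subseteq> val_ring"
    "\<And>x. x \<in> val_ring \<Longrightarrow> \<exists>d\<in>D. \<exists>y\<in>val_ring. x - d = c * y"
proof -
  have c: "0 < absv c"
    using assms by simp
  obtain D :: "'f set" where D: "finite D" "D \<subseteq> val_ring" "val_ring \<subseteq> (\<Union>d\<in>D. ball d (absv c))"
    using seq_compact_imp_totally_bounded[OF compact_imp_seq_compact[OF compact_val_ring], rule_format, OF c]
    by auto
  show thesis
  proof (rule that[OF D(1,2)])
    fix x :: 'f assume "x \<in> val_ring"
    then obtain d where "d \<in> D" "x \<in> ball d (absv c)"
      using D(3) by blast
    then have d: "d \<in> D" "absv (x - d) < absv c"
      by (simp_all add: dist_commute[of d] flip: dist_absv)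
    have "absv (inverse c * (x - d)) = inverse (absv c) * absv (x - d)"
      using assms by (simp add: absv_mult absv_inverse)
    also have "\<dots> \<le> inverse (absv c) * absv c"
      using d c by (intro mult_left_mono) (auto simp: absv_nonneg)
    also have "\<dots> = 1"
      using c by simp
    finally have "inverse c * (x - d) \<in> val_ring"
      by (simp add: val_ring_def)
    moreover have "x - d = c * (inverse c * (x - d))"
      using assms by simp
    ultimately show "\<exists>d\<in>D. \<exists>y\<in>val_ring. x - d = c * y"
      using d(1) by blast
  qed
qed

section \<open>Scalar multiplication and metric on matrices\<close>

lemma mscale_nth [simp]: "mscale c A $ i $ j = c * A $ i $ j"
  by (simp add: mscale_def)

lemma vector_space_mscale: "vector_space (mscale :: 'f::field \<Rightarrow> 'f^'n^'n \<Rightarrow> 'f^'n^'n)"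
  by unfold_locales (simp_all add: vec_eq_iff algebra_simps)

interpretation mat: vector_space "mscale :: 'f::field \<Rightarrow> 'f^'n^'n \<Rightarrow> 'f^'n^'n"
  by (rule vector_space_mscale)

lemma absv_entry_le_dist:
  fixes x y :: "'f::nonarch_local_field^'n^'n"
  shows "absv (x $ i $ j - y $ i $ j) \<le> dist x y"
proof -
  have "absv (x $ i $ j - y $ i $ j) = dist (x $ i $ j) (y $ i $ j)"
    by (simp add: dist_absv)
  also have "\<dots> \<le> dist (x $ i) (y $ i)"
    by (rule dist_vec_nth_le)
  also have "\<dots> \<le> dist x y"
    by (rule dist_vec_nth_le)
  finally show ?thesis .
qed

text \<open>The metric on matrices is a nested L2 metric, not the maximum over entries. Bounding L2
  by the sum costs a factor \<open>CARD('n)\<close> at each of the two levels.\<close>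

lemma dist_le_entries:
  fixes x y :: "'f::nonarch_local_field^'n::finite^'n"
  assumes "\<And>i j. absv (x $ i $ j - y $ i $ j) \<le> e"
  shows "dist x y \<le> real CARD('n) * (real CARD('n) * e)"
proof -
  have row: "dist (x $ i) (y $ i) \<le> real CARD('n) * e" for i
  proof -
    have "dist (x $ i) (y $ i) \<le> (\<Sum>j\<in>UNIV. dist (x $ i $ j) (y $ i $ j))"
      unfolding dist_vec_def[of "x $ i"] by (rule L2_set_le_sum) simp
    also have "\<dots> \<le> (\<Sum>j::'n\<in>UNIV. e)"
      by (intro sum_mono) (simp add: dist_absv assms)
    finally show ?thesis by simp
  qed
  have "dist x y \<le> (\<Sum>i\<in>UNIV. dist (x $ i) (y $ i))"
    unfolding dist_vec_def[of x] by (rule L2_set_le_sum) simp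
  also have "\<dots> \<le> (\<Sum>i::'n\<in>UNIV. real CARD('n) * e)"
    by (intro sum_mono row)
  finally show ?thesis by simp
qed

lemma dist_mat_add_right [simp]:
  fixes x y z :: "'f::nonarch_local_field^'n::finite^'n"
  shows "dist (x + z) (y + z) = dist x y" "dist (z + x) (z + y) = dist x y"
  by (simp_all add: dist_vec_def dist_absv)

lemma dist_mscale:
  fixes x y :: "'f::nonarch_local_field^'n::finite^'n"
  shows "dist (mscale c x) (mscale c y) = absv c * dist x y"
  by (simp add: dist_vec_def dist_absv absv_mult L2_set_right_distrib absv_nonneg
      flip: right_diff_distrib)

lemma dist_mat_add_le:
  fixes x y :: "'f::nonarch_local_field^'n::finite^'n"
  shows "dist (x + y) (x' + y') \<le> dist x x' + dist y y'"
  using dist_triangle[of "x + y" "x' + y'" "x' + y"] by simp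

section \<open>Integral spans of finite sets: compactness and residues\<close>

lemma compact_image_scalars:
  fixes v :: "'f::nonarch_local_field^'n::finite^'n"
  shows "compact ((\<lambda>c. mscale c v) ` val_ring)"
proof (rule compact_continuous_image[OF _ compact_val_ring])
  show "continuous_on val_ring (\<lambda>c. mscale c v)"
    unfolding mscale_def
    by (intro continuous_on_vec_lambda) (subst mult.commute, rule continuous_on_mult_left_val)
qed

lemma compact_mat_add:
  fixes S T :: "('f::nonarch_local_field^'n::finite^'n) set"
  assumes "compact S" "compact T"
  shows "compact {x + y | x y. x \<in> S \<and> y \<in> T}"
proof -
  have "continuous_on (S \<times> T) (\<lambda>p. fst p + snd p)"
  proof (rule continuous_on_iff[THEN iffD2], intro ballI allI impI)
    fix p :: "('f^'n^'n) \<times> ('f^'n^'n)" and e :: real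
    assume "0 < e"
    show "\<exists>d>0. \<forall>p'\<in>S \<times> T. dist p' p < d \<longrightarrow> dist (fst p' + snd p') (fst p + snd p) < e"
    proof (intro exI[of _ "e / 2"] conjI ballI impI)
      fix p' assume "dist p' p < e / 2"
      then have "dist (fst p') (fst p) < e / 2" "dist (snd p') (snd p) < e / 2"
        using dist_fst_le[of p' p] dist_snd_le[of p' p] by linarith+
      then show "dist (fst p' + snd p') (fst p + snd p) < e"
        using dist_mat_add_le[of "fst p'" "snd p'" "fst p" "snd p"] by linarith
    qed (use \<open>0 < e\<close> in simp)
  qed
  then have "compact ((\<lambda>p. fst p + snd p) ` (S \<times> T))"
    by (rule compact_continuous_image) (intro compact_Times assms)
  moreover have "(\<lambda>p. fst p + snd p) ` (S \<times> T) = {x + y | x y. x \<in> S \<and> y \<in> T}"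
    by force
  ultimately show ?thesis by simp
qed

text \<open>Isolates the module occurring in \<open>is_lattice\<close>, so that induction on the
  generators applies. Independence of \<open>E\<close> enters only with the dual basis.\<close>

definition int_span :: "('f::nonarch_local_field^'n^'n) set \<Rightarrow> ('f^'n^'n) set" where
  "int_span E = {\<Sum>e\<in>E. mscale (c e) e | c. \<forall>e\<in>E. c e \<in> val_ring}"

lemma int_spanI: "x = (\<Sum>e\<in>E. mscale (c e) e) \<Longrightarrow> (\<And>e. e \<in> E \<Longrightarrow> c e \<in> val_ring) \<Longrightarrow> x \<in> int_span E"
  unfolding int_span_def by blast

lemma int_spanE:
  assumes "x \<in> int_span E"
  obtains c where "x = (\<Sum>e\<in>E. mscale (c e) e)" "\<forall>e\<in>E. c e \<in> val_ring"
  using assms unfolding int_span_def by blast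

text \<open>Written as a sum of two sets so that \<open>compact_mat_add\<close> gives the induction
  step for compactness.\<close>

lemma int_span_insert:
  assumes "finite E" "v \<notin> E"
  shows "int_span (insert v E) = {x + y | x y. x \<in> (\<lambda>c. mscale c v) ` val_ring \<and> y \<in> int_span E}"
proof (intro equalityI subsetI)
  fix z assume "z \<in> int_span (insert v E)"
  then obtain c where c: "z = (\<Sum>e\<in>insert v E. mscale (c e) e)"
    "\<forall>e\<in>insert v E. c e \<in> val_ring"
    using int_spanE by blast
  then have "z = mscale (c v) v + (\<Sum>e\<in>E. mscale (c e) e)" "c v \<in> val_ring"
    "(\<Sum>e\<in>E. mscale (c e) e) \<in> int_span E"
    using assms by (auto intro: int_spanI)
  then show "z \<in> {x + y | x y. x \<in> (\<lambda>c. mscale c v) ` val_ring \<and> y \<in> int_span E}"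
    by blast
next
  fix z assume "z \<in> {x + y | x y. x \<in> (\<lambda>c. mscale c v) ` val_ring \<and> y \<in> int_span E}"
  then obtain d c where dc: "d \<in> val_ring" "\<forall>e\<in>E. c e \<in> val_ring"
    "z = mscale d v + (\<Sum>e\<in>E. mscale (c e) e)"
    using int_spanE by blast
  have "(\<Sum>e\<in>E. mscale (c e) e) = (\<Sum>e\<in>E. mscale ((c(v := d)) e) e)"
    using assms by (intro sum.cong) auto
  then have "z = (\<Sum>e\<in>insert v E. mscale ((c(v := d)) e) e)"
    using assms dc by simp
  then show "z \<in> int_span (insert v E)"
    by (rule int_spanI) (use dc in auto)
qed

lemma compact_int_span:
  fixes E :: "('f::nonarch_local_field^'n::finite^'n) set"
  assumes "finite E"
  shows "compact (int_span E)"
  using assms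
proof (induction E)
  case empty
  show ?case by (simp add: int_span_def)
next
  case (insert v E)
  then show ?case
    unfolding int_span_insert[OF insert.hyps]
    by (intro compact_mat_add compact_image_scalars)
qed

lemma int_span_zero: "0 \<in> int_span E"
  by (rule int_spanI[where c = "\<lambda>_. 0"]) simp_all

lemma int_span_add:
  assumes "x \<in> int_span E" "y \<in> int_span E"
  shows "x + y \<in> int_span E"
proof -
  obtain c where c: "x = (\<Sum>e\<in>E. mscale (c e) e)" "\<forall>e\<in>E. c e \<in> val_ring"
    using int_spanE[OF assms(1)] .
  obtain d where d: "y = (\<Sum>e\<in>E. mscale (d e) e)" "\<forall>e\<in>E. d e \<in> val_ring"
    using int_spanE[OF assms(2)] .
  show ?thesis
    by (rule int_spanI[where c = "\<lambda>e. c e + d e"])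
      (simp_all add: c d mat.scale_left_distrib sum.distrib val_ring_closed)
qed

lemma int_span_scale:
  assumes "r \<in> val_ring" "x \<in> int_span E"
  shows "mscale r x \<in> int_span E"
proof -
  obtain c where c: "x = (\<Sum>e\<in>E. mscale (c e) e)" "\<forall>e\<in>E. c e \<in> val_ring"
    using int_spanE[OF assms(2)] .
  show ?thesis
    by (rule int_spanI[where c = "\<lambda>e. r * c e"])
      (simp_all add: c assms mat.scale_sum_right val_ring_closed)
qed

lemma int_span_base:
  assumes "finite E" "e \<in> E"
  shows "e \<in> int_span E"
proof (rule int_spanI[where c = "\<lambda>b. if b = e then 1 else 0"])
  have "(\<Sum>b\<in>E. mscale (if b = e then 1 else 0) b) = (\<Sum>b\<in>E. if b = e then b else 0)"
    by (intro sum.cong) auto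
  then show "e = (\<Sum>b\<in>E. mscale (if b = e then 1 else 0) b)"
    using assms by simp
qed simp

lemma finite_int_span_residues:
  fixes E :: "('f::nonarch_local_field^'n::finite^'n) set"
  assumes "finite E" "c \<noteq> 0"
  obtains S where "finite S" "S \<subseteq> int_span E"
    "\<And>x. x \<in> int_span E \<Longrightarrow> \<exists>s\<in>S. x - s \<in> mscale c ` int_span E"
proof -
  obtain D where D: "finite D" "D \<subseteq> val_ring"
    "\<And>x. x \<in> val_ring \<Longrightarrow> \<exists>d\<in>D. \<exists>y\<in>val_ring. x - d = c * y"
    using finite_residues[OF assms(2)] by blast
  \<comment> \<open>Residues are chosen coordinate by coordinate; extensional functions keep the set
    of choices finite.\<close>
  define S where "S = (\<lambda>f. \<Sum>e\<in>E. mscale (f e) e) ` (E \<rightarrow>\<^sub>E D)"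
  show thesis
  proof (rule that[of S])
    show "finite S"
      unfolding S_def by (intro finite_imageI finite_PiE assms D)
    show "S \<subseteq> int_span E"
      using D(2) by (auto simp: S_def PiE_iff intro!: int_spanI)
    fix x assume "x \<in> int_span E"
    then obtain b where b: "x = (\<Sum>e\<in>E. mscale (b e) e)" "\<forall>e\<in>E. b e \<in> val_ring"
      using int_spanE by blast
    have "\<forall>e\<in>E. \<exists>d y. d \<in> D \<and> y \<in> val_ring \<and> b e - d = c * y"
      using b(2) D(3) by blast
    then obtain d y where dy: "\<forall>e\<in>E. d e \<in> D \<and> y e \<in> val_ring \<and> b e - d e = c * y e"
      by metis
    have S: "(\<Sum>e\<in>E. mscale (d e) e) \<in> S"
      unfolding S_def using dy
      by (intro image_eqI[where x = "restrict d E"]) (auto intro!: sum.cong)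
    have "x - (\<Sum>e\<in>E. mscale (d e) e) = (\<Sum>e\<in>E. mscale (b e - d e) e)"
      by (simp add: b(1) sum_subtractf mat.scale_left_diff_distrib)
    also have "\<dots> = mscale c (\<Sum>e\<in>E. mscale (y e) e)"
      using dy by (simp add: mat.scale_sum_right)
    finally have "x - (\<Sum>e\<in>E. mscale (d e) e) \<in> mscale c ` int_span E"
      using dy by (auto intro!: imageI int_spanI[where c = y])
    then show "\<exists>s\<in>S. x - s \<in> mscale c ` int_span E"
      using S by blast
  qed
qed

lemma lattice_int_span:
  assumes "is_lattice mscale V (L :: ('f::nonarch_local_field^'n::finite^'n) set)"
  obtains E where "finite E" "mat.independent E" "mat.span E = V" "L = int_span E"
  using assms unfolding is_lattice_def int_span_def by blast

section \<open>Analytic maps are continuous\<close>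

lemma has_sum_entry:
  fixes f :: "'e \<Rightarrow> 'f::nonarch_local_field^'n::finite^'n"
  assumes "(f has_sum s) A"
  shows "((\<lambda>e. f e $ i $ j) has_sum (s $ i $ j)) A"
  using tendsto_vec_nth[OF tendsto_vec_nth[OF assms[unfolded has_sum_def], of i], of j]
  unfolding has_sum_def by (simp add: o_def)

text \<open>A term outside a large finite set \<open>Z\<close> is the difference of two partial
  sums, both within distance 1 of the limit; the finitely many terms in \<open>Z\<close> are bounded
  by their sum.\<close>

lemma has_sum_absv_bounded:
  fixes g :: "'e \<Rightarrow> 'f::nonarch_local_field"
  assumes "(g has_sum s) UNIV"
  obtains C where "\<And>e. absv (g e) \<le> C"
proof -
  have "\<forall>\<^sub>F Z in finite_subsets_at_top UNIV. dist (sum g Z) s < 1"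
    using tendstoD[OF assms[unfolded has_sum_def], of 1] by simp
  then obtain Z where Z: "finite Z"
    "\<forall>Y. finite Y \<and> Z \<subseteq> Y \<longrightarrow> absv (sum g Y - s) < 1"
    unfolding eventually_finite_subsets_at_top dist_absv by auto
  show thesis
  proof (rule that[of "max 1 (\<Sum>e\<in>Z. absv (g e))"])
    fix e
    show "absv (g e) \<le> max 1 (\<Sum>e\<in>Z. absv (g e))"
    proof (cases "e \<in> Z")
      case True
      then have "absv (g e) \<le> (\<Sum>e\<in>Z. absv (g e))"
        by (rule member_le_sum) (simp_all add: Z)
      then show ?thesis by simp
    next
      case False
      have "absv (sum g (insert e Z) - s) < 1" "absv (sum g Z - s) < 1"
        using Z by (simp_all add: subset_insertI)
      moreover have "absv (g e) = absv ((sum g (insert e Z) - s) - (sum g Z - s))"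
        using False Z(1) by (intro arg_cong[where f = absv]) simp
      ultimately have "absv (g e) \<le> 1"
        using absv_diff_le[of "sum g (insert e Z) - s" "sum g Z - s"] by linarith
      then show ?thesis by simp
    qed
  qed
qed

text \<open>By the ultrametric inequality a uniform bound on the terms passes to the sums, with no
  summable majorant. It suffices to compare partial sums over one finite set on which both are
  within \<open>b\<close> of their limits.\<close>

lemma has_sum_absv_diff_le:
  fixes g g' :: "'e \<Rightarrow> 'f::nonarch_local_field"
  assumes "(g has_sum s) A" "(g' has_sum s') A" "\<And>e. e \<in> A \<Longrightarrow> absv (g e - g' e) \<le> b" "0 < b"
  shows "absv (s - s') \<le> b"
proof -
  have "\<forall>\<^sub>F Z in finite_subsets_at_top A. dist (sum g Z) s < b"
    "\<forall>\<^sub>F Z in finite_subsets_at_top A. dist (sum g' Z) s' < b"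
    using tendstoD[OF assms(1)[unfolded has_sum_def] assms(4)]
      tendstoD[OF assms(2)[unfolded has_sum_def] assms(4)] by simp_all
  moreover have "\<forall>\<^sub>F Z in finite_subsets_at_top A. Z \<subseteq> A"
    by (rule eventually_finite_subsets_at_top_weakI)
  ultimately have "\<forall>\<^sub>F Z in finite_subsets_at_top A. dist (sum g Z) s < b \<and> dist (sum g' Z) s' < b \<and> Z \<subseteq> A"
    by eventually_elim simp
  then obtain Z where Z: "dist (sum g Z) s < b" "dist (sum g' Z) s' < b" "Z \<subseteq> A"
    using eventually_happens'[OF finite_subsets_at_top_neq_bot] by blast
  have "absv (sum g Z - sum g' Z) \<le> b"
    unfolding sum_subtractf[symmetric] by (rule absv_sum_le) (use Z(3) assms in auto)
  moreover have "absv (s - s') = absv (((sum g Z - sum g' Z) - (sum g Z - s)) + (sum g' Z - s'))"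
    by (rule arg_cong[where f = absv]) simp
  ultimately show ?thesis
    using Z(1,2) absv_ultrametric[of "(sum g Z - sum g' Z) - (sum g Z - s)" "sum g' Z - s'"]
      absv_diff_le[of "sum g Z - sum g' Z" "sum g Z - s"]
    unfolding dist_absv by linarith
qed

text \<open>Subtracting the value at 0 kills the constant monomial. Any other monomial has a factor
  of size at most \<open>d\<close>, and its remaining factors are at most \<open>w\<close>.
  Multiplying by \<open>w\<close> on the left restores the full exponent without a division.\<close>

lemma absv_monomial_diff_le:
  fixes h :: "'p::finite \<Rightarrow> 'f::nonarch_local_field"
  assumes "\<And>p. absv (h p) \<le> d" "d \<le> w"
  shows "absv ((\<Prod>p\<in>UNIV. h p ^ e p) - (\<Prod>p\<in>UNIV. 0 ^ e p)) * w \<le> d * (\<Prod>p\<in>UNIV. w ^ e p)"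
proof (cases "\<exists>q. e q \<noteq> 0")
  case True
  then obtain q k where q: "e q = Suc k"
    using not0_implies_Suc by blast
  have d: "0 \<le> d"
    using order_trans[OF absv_nonneg assms(1)] .
  then have w: "0 \<le> w"
    using assms(2) by linarith
  have zero: "(\<Prod>p\<in>UNIV. 0 ^ e p) = (0::'f)"
    by (rule prod_zero) (use q in \<open>auto intro!: exI[of _ q]\<close>)
  have le: "absv (h p) ^ m \<le> w ^ m" for p m
    by (intro power_mono order_trans[OF assms(1) assms(2)]) simp
  have hq: "absv (h q) ^ e q \<le> d * w ^ k"
    unfolding q power_Suc by (intro mult_mono assms(1) le) (simp_all add: d)
  have "absv (\<Prod>p\<in>UNIV. h p ^ e p) = absv (h q) ^ e q * (\<Prod>p\<in>UNIV - {q}. absv (h p) ^ e p)"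
    by (simp add: absv_prod absv_power absv_mult prod.remove[of UNIV q])
  also have "\<dots> \<le> (d * w ^ k) * (\<Prod>p\<in>UNIV - {q}. w ^ e p)"
    by (intro mult_mono hq prod_mono conjI le prod_nonneg) (simp_all add: d w)
  finally have "absv (\<Prod>p\<in>UNIV. h p ^ e p) * w \<le> (d * w ^ k) * (\<Prod>p\<in>UNIV - {q}. w ^ e p) * w"
    by (rule mult_right_mono[OF _ w])
  also have "\<dots> = d * (w ^ e q * (\<Prod>p\<in>UNIV - {q}. w ^ e p))"
    by (simp add: q)
  also have "\<dots> = d * (\<Prod>p\<in>UNIV. w ^ e p)"
    by (simp add: prod.remove[of UNIV q])
  finally show ?thesis
    by (simp add: zero)
next
  case False
  have "0 \<le> d" "0 \<le> w"
    using order_trans[OF absv_nonneg assms(1)] assms(2) by auto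
  with False show ?thesis by simp
qed

text \<open>
  The terms of a series summable at the constant matrix \<open>t\<close> are bounded there, so at arguments
  of size \<open>d \<le> absv t\<close> every nonconstant term is at most a constant times \<open>d\<close>.
\<close>

lemma continuous_on_analytic:
  fixes f :: "'f::nonarch_local_field^'n::finite^'n \<Rightarrow> 'f^'n^'n"
  assumes "analytic_map_on S f"
  shows "continuous_on S f"
proof (rule continuous_on_iff[THEN iffD2], intro ballI allI impI)
  fix p :: "'f^'n^'n" and \<epsilon> :: real
  assume "p \<in> S" and \<epsilon>: "0 < \<epsilon>"
  then obtain c F r where r: "r > 0" and H: "\<And>h. (\<forall>i j. absv (h $ i $ j) < r) \<Longrightarrow>
        ((\<lambda>e. mscale (\<Prod>(i, j)\<in>UNIV. (h $ i $ j) ^ e (i, j)) (c e)) has_sum F h) UNIV \<and>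
        (p + h \<in> S \<longrightarrow> f (p + h) = F h)"
    using assms unfolding analytic_map_on_def by (smt (verit))
  obtain t :: 'f where t: "t \<noteq> 0" "absv t < r"
    using absv_less_pos_exists[OF r] .
  have hs: "((\<lambda>e. (\<Prod>x\<in>UNIV. (h $ fst x $ snd x) ^ e x) * c e $ i $ j) has_sum F h $ i $ j) UNIV"
    if "\<forall>i j. absv (h $ i $ j) < r" for h i j
    using has_sum_entry[OF conjunct1[OF H[OF that]], of i j] by (simp add: split_def)
  have "\<exists>C. \<forall>e. absv ((\<Prod>x\<in>UNIV. t ^ e x) * c e $ i $ j) \<le> C" for i j
    using has_sum_absv_bounded[OF hs[of "\<chi> i j. t" i j]] t by auto
  then obtain C where C: "\<And>i j e. absv ((\<Prod>x\<in>UNIV. t ^ e x) * c e $ i $ j) \<le> C i j"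
    by metis
  \<comment> \<open>One bound for all entries; the summand 1 makes it strictly positive.\<close>
  define D where "D = 1 + (\<Sum>i\<in>UNIV. \<Sum>j\<in>UNIV. C i j)"
  have C0: "0 \<le> C i j" for i j
    using order_trans[OF absv_nonneg C] .
  have CD: "C i j \<le> D" for i j
  proof -
    have "C i j \<le> (\<Sum>j\<in>UNIV. C i j)"
      by (rule member_le_sum) (simp_all add: C0)
    also have "\<dots> \<le> (\<Sum>i\<in>UNIV. \<Sum>j\<in>UNIV. C i j)"
      by (rule member_le_sum[where f = "\<lambda>i. \<Sum>j\<in>UNIV. C i j"]) (simp_all add: C0 sum_nonneg)
    finally show ?thesis by (simp add: D_def)
  qed
  have D: "0 < D"
    unfolding D_def by (intro add_pos_nonneg sum_nonneg C0) simp
  define N where "N = real CARD('n) * real CARD('n)"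
  have N: "0 < N" by (simp add: N_def)
  have w: "0 < absv t" using t by simp
  \<comment> \<open>\<open>N\<close> pays for passing from entries to the matrix metric,
    \<open>D / absv t\<close> is the constant in the bound for a single term, and the 2 makes the
    final inequality strict.\<close>
  define d where "d = min (absv t) (\<epsilon> * absv t / (2 * N * D))"
  have d: "0 < d" "d \<le> absv t" "N * (d * D / absv t) < \<epsilon>"
  proof -
    show "0 < d"
      using w \<epsilon> N D unfolding d_def by (simp only: min_less_iff_conj zero_less_divide_iff) simp
    show "d \<le> absv t" by (simp add: d_def)
    have "d \<le> \<epsilon> * absv t / (2 * N * D)" by (simp add: d_def)
    then have "d * (2 * N * D) \<le> \<epsilon> * absv t"
      using N D by (simp add: pos_le_divide_eq)
    then have "N * (d * D / absv t) \<le> \<epsilon> / 2"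
      using w by (simp add: pos_divide_le_eq algebra_simps del: absv_pos_iff)
    also have "\<dots> < \<epsilon>"
      using \<epsilon> by simp
    finally show "N * (d * D / absv t) < \<epsilon>" .
  qed
  show "\<exists>\<delta>>0. \<forall>x\<in>S. dist x p < \<delta> \<longrightarrow> dist (f x) (f p) < \<epsilon>"
  proof (intro exI[of _ d] conjI ballI impI)
    fix x assume x: "x \<in> S" "dist x p < d"
    define h where "h = x - p"
    have h: "absv (h $ i $ j) \<le> d" for i j
      using absv_entry_le_dist[of x i j p] x(2) by (simp add: h_def)
    have hr: "\<forall>i j. absv (h $ i $ j) < r"
      using h d(2) t(2) by (meson le_less_trans order_trans)
    have zr: "\<forall>i j. absv ((0 :: 'f^'n^'n) $ i $ j) < r"
      using r by simp
    have "absv (F h $ i $ j - F 0 $ i $ j) \<le> d * D / absv t" for i j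
    proof (rule has_sum_absv_diff_le[OF hs[OF hr] hs[OF zr]])
      fix e :: "'n \<times> 'n \<Rightarrow> nat"
      let ?m = "\<Prod>x\<in>UNIV. (h $ fst x $ snd x) ^ e x"
      let ?z = "\<Prod>x\<in>UNIV. ((0 :: 'f^'n^'n) $ fst x $ snd x) ^ e x"
      have "absv (?m - ?z) * absv t \<le> d * (\<Prod>x\<in>UNIV. absv t ^ e x)"
        using absv_monomial_diff_le[of "\<lambda>x. h $ fst x $ snd x" d "absv t" e] h d(2) by simp
      then have "absv (?m - ?z) * absv t * absv (c e $ i $ j) \<le>
          d * (\<Prod>x\<in>UNIV. absv t ^ e x) * absv (c e $ i $ j)"
        by (rule mult_right_mono) simp
      also have "\<dots> = d * absv ((\<Prod>x\<in>UNIV. t ^ e x) * c e $ i $ j)"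
        by (simp add: absv_mult absv_prod absv_power)
      also have "\<dots> \<le> d * D"
        by (intro mult_left_mono order_trans[OF C CD]) (use d in simp)
      finally have "absv (?m - ?z) * absv (c e $ i $ j) \<le> d * D / absv t"
        using w by (simp add: pos_le_divide_eq algebra_simps del: absv_pos_iff)
      then show "absv (?m * c e $ i $ j - ?z * c e $ i $ j) \<le> d * D / absv t"
        by (simp add: absv_mult flip: left_diff_distrib)
    next
      show "0 < d * D / absv t"
        using d(1) D w by (intro divide_pos_pos mult_pos_pos)
    qed
    then have "dist (F h) (F 0) \<le> N * (d * D / absv t)"
      using dist_le_entries[of "F h" "F 0" "d * D / absv t"] by (simp add: N_def mult.assoc)
    moreover have "f x = F h" "f p = F 0"
      using H[OF hr] H[OF zr] x(1) \<open>p \<in> S\<close> by (simp_all add: h_def)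
    ultimately show "dist (f x) (f p) < \<epsilon>"
      using d(3) by simp
  qed (use d in simp)
qed

section \<open>The group law in exponential coordinates\<close>

text \<open>Collects the facts about the exponential on which the filtration argument rests, with
  analyticity already turned into continuity; the final theorem instantiates it.\<close>

locale exp_lattice =
  fixes \<pi> :: "'f::nonarch_local_field" and E L K :: "('f^'n::finite^'n) set"
    and ex :: "'f^'n^'n \<Rightarrow> 'f^'n^'n"
  assumes uniformizer: "uniformizer \<pi>"
    and finite_basis: "finite E"
    and L_eq: "L = int_span E"
    and K_subgroup: "subgroup K GL"
    and ex_bij: "bij_betw ex L K"
    and ex_continuous: "continuous_on L ex"
    and ex_line: "\<lbrakk>x \<in> L; s \<in> val_ring; t \<in> val_ring\<rbrakk>
      \<Longrightarrow> ex (mscale s x + mscale t x) = ex (mscale s x) ** ex (mscale t x)"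
    and ex_product: "\<lbrakk>x \<in> mscale (\<pi> ^ i) ` L; y \<in> mscale (\<pi> ^ j) ` L\<rbrakk>
      \<Longrightarrow> inv_into L ex (ex x ** ex y) - x - y \<in> mscale (\<pi> ^ (i + j)) ` L"
begin

definition lat :: "nat \<Rightarrow> ('f^'n^'n) set" where
  "lat k = mscale (\<pi> ^ k) ` L"

abbreviation log :: "'f^'n^'n \<Rightarrow> 'f^'n^'n" where
  "log \<equiv> inv_into L ex"

definition star :: "'f^'n^'n \<Rightarrow> 'f^'n^'n \<Rightarrow> 'f^'n^'n" (infixl \<open>\<star>\<close> 70) where
  "x \<star> y = log (ex x ** ex y)"

lemma lat_eq: "lat k = mscale (\<pi> ^ k) ` int_span E"
  unfolding lat_def by (simp only: L_eq)

lemma lat_0 [simp]: "lat 0 = L"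
  by (simp add: lat_def)

lemma zero_in_lat [simp]: "0 \<in> lat k"
  unfolding lat_eq by (rule image_eqI[OF _ int_span_zero]) simp

lemma lat_add: "x \<in> lat k \<Longrightarrow> y \<in> lat k \<Longrightarrow> x + y \<in> lat k"
  unfolding lat_eq by (auto simp flip: mat.scale_right_distrib intro: int_span_add)

lemma lat_uminus: "x \<in> lat k \<Longrightarrow> - x \<in> lat k"
proof -
  assume "x \<in> lat k"
  then obtain z where z: "x = mscale (\<pi> ^ k) z" "z \<in> int_span E"
    by (auto simp: lat_eq)
  have "mscale (- 1) z \<in> int_span E"
    using z(2) by (intro int_span_scale) (simp_all add: val_ring_def)
  then show ?thesis
    unfolding lat_eq by (rule rev_image_eqI) (simp add: z(1))
qed

lemma lat_diff: "x \<in> lat k \<Longrightarrow> y \<in> lat k \<Longrightarrow> x - y \<in> lat k"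
  using lat_add[of x k "- y"] lat_uminus[of y k] by simp

lemma lat_mono:
  assumes "j \<le> k"
  shows "lat k \<subseteq> lat j"
proof
  fix x assume "x \<in> lat k"
  then obtain z where z: "x = mscale (\<pi> ^ k) z" "z \<in> int_span E"
    by (auto simp: lat_eq)
  have "mscale (\<pi> ^ (k - j)) z \<in> int_span E"
    by (intro int_span_scale uniformizerD(4)[OF uniformizer] z(2))
  moreover have "x = mscale (\<pi> ^ j) (mscale (\<pi> ^ (k - j)) z)"
    using assms by (simp add: z(1) flip: power_add)
  ultimately show "x \<in> lat j"
    unfolding lat_eq by blast
qed

lemma lat_le: "x \<in> lat k \<Longrightarrow> j \<le> k \<Longrightarrow> x \<in> lat j"
  using lat_mono by blast

lemma lat_L: "x \<in> lat k \<Longrightarrow> x \<in> L"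
  using lat_mono[of 0 k] by auto

lemma ex_in_K: "x \<in> L \<Longrightarrow> ex x \<in> K"
  using ex_bij by (auto dest: bij_betwE)

lemma log_ex [simp]: "x \<in> L \<Longrightarrow> log (ex x) = x"
  using ex_bij by (simp add: bij_betw_def)

lemma ex_log: "g \<in> K \<Longrightarrow> ex (log g) = g"
  and log_in_L: "g \<in> K \<Longrightarrow> log g \<in> L"
  using ex_bij by (auto simp: bij_betw_def f_inv_into_f inv_into_into)

lemma K_mult: "g \<in> K \<Longrightarrow> h \<in> K \<Longrightarrow> g ** h \<in> K"
  using subgroup.m_closed[OF K_subgroup, of g h] by (simp add: GL_def)

lemma K_invertible: "g \<in> K \<Longrightarrow> invertible g"
  using subgroup.subset[OF K_subgroup] by (auto simp: GL_def)

lemma star_closed: "x \<in> L \<Longrightarrow> y \<in> L \<Longrightarrow> x \<star> y \<in> L"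
  by (simp add: star_def log_in_L K_mult ex_in_K)

lemma ex_star: "x \<in> L \<Longrightarrow> y \<in> L \<Longrightarrow> ex (x \<star> y) = ex x ** ex y"
  by (simp add: star_def ex_log K_mult ex_in_K)

text \<open>The one-parameter law at \<open>s = t = 0\<close> makes \<open>ex 0\<close> idempotent,
  and an invertible idempotent is the identity.\<close>

lemma ex_zero: "ex 0 = mat 1"
proof -
  have 0: "0 \<in> L"
    using zero_in_lat[of 0] by simp
  have "ex 0 = ex 0 ** ex 0"
    using ex_line[OF 0, of 0 0] by simp
  moreover obtain h where "h ** ex 0 = mat 1"
    using K_invertible[OF ex_in_K[OF 0]] by (auto simp: invertible_def)
  ultimately show ?thesis
    by (metis matrix_mul_assoc matrix_mul_lid)
qed

lemma star_assoc: "x \<in> L \<Longrightarrow> y \<in> L \<Longrightarrow> z \<in> L \<Longrightarrow> x \<star> y \<star> z = x \<star> (y \<star> z)"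
  unfolding star_def[of "x \<star> y"] star_def[of x "y \<star> z"] by (simp add: ex_star matrix_mul_assoc)

lemma star_zero [simp]: "x \<in> L \<Longrightarrow> x \<star> 0 = x" "x \<in> L \<Longrightarrow> 0 \<star> x = x"
  by (simp_all add: star_def ex_zero)

lemma uminus_in_L: "x \<in> L \<Longrightarrow> - x \<in> L"
  using lat_uminus[of x 0] by simp

text \<open>Negation is the group inverse because \<open>ex\<close> is a homomorphism on the
  integral multiples of \<open>x\<close>.\<close>

lemma star_uminus [simp]: "x \<in> L \<Longrightarrow> x \<star> - x = 0" "x \<in> L \<Longrightarrow> - x \<star> x = 0"
proof -
  assume x: "x \<in> L"
  have minus_one: "- 1 \<in> (val_ring :: 'f set)"
    by (simp add: val_ring_def)
  have "ex x ** ex (- x) = ex 0" "ex (- x) ** ex x = ex 0"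
    using ex_line[OF x, of 1 "- 1"] ex_line[OF x, of "- 1" 1] minus_one by simp_all
  then show "x \<star> - x = 0" "- x \<star> x = 0"
    using zero_in_lat[of 0] by (simp_all add: star_def)
qed

lemma star_approx: "x \<in> lat i \<Longrightarrow> y \<in> lat j \<Longrightarrow> x \<star> y - x - y \<in> lat (i + j)"
  using ex_product by (simp add: star_def lat_def)

lemma star_uminus_cancel: "x \<in> L \<Longrightarrow> y \<in> L \<Longrightarrow> x \<star> (- x \<star> y) = y"
  "x \<in> L \<Longrightarrow> y \<in> L \<Longrightarrow> y \<star> x \<star> - x = y"
  by (simp_all add: uminus_in_L star_assoc flip: star_assoc[of x "- x" y])

text \<open>Depth 0 of \<open>x\<close> is enough here: the remainder in \<open>star_approx\<close>
  already lies in \<open>lat (0 + m)\<close>.\<close>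

lemma star_right_diff:
  assumes "x \<in> L" "u \<in> lat m"
  shows "x \<star> u - x \<in> lat m"
  using lat_add[of "x \<star> u - x - u" m u] star_approx[of x 0 u m] assms by simp

lemma star_left_diff:
  assumes "x \<in> L" "u \<in> lat m"
  shows "u \<star> x - x \<in> lat m"
  using lat_add[of "u \<star> x - u - x" m u] star_approx[of u m x 0] assms by simp

text \<open>
  Writing \<open>x' = x \<star> u\<close>, each application of \<open>star_approx\<close> improves the knowledge about \<open>u\<close> by the
  depth of \<open>x\<close>, until the depth of \<open>x' - x\<close> is reached.
\<close>

lemma star_uminus_in_lat:
  assumes x: "x \<in> lat k" "0 < k" and d: "x' - x \<in> lat m"
  shows "- x \<star> x' \<in> lat m"
proof -
  have xL: "x \<in> L" and x'L: "x' \<in> L"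
    using lat_L[OF x(1)] lat_add[of "x' - x" 0 x] lat_L[OF d] by simp_all
  define u where "u = - x \<star> x'"
  have u: "u \<in> L" "x' = x \<star> u"
    unfolding u_def using xL x'L by (simp_all add: star_closed uminus_in_L star_uminus_cancel)
  have "u \<in> lat (min m j)" for j
  proof (induction j)
    case 0
    then show ?case using u by simp
  next
    case (Suc j)
    \<comment> \<open>Since \<open>0 < k\<close>, the remainder has depth
      \<open>k + min m j\<close>, which is at least \<open>min m (Suc j)\<close>.\<close>
    have "x' - x - u \<in> lat (min m (Suc j))"
      using lat_le[OF star_approx[OF x(1) Suc]] x(2) by (simp add: u(2))
    moreover have "x' - x \<in> lat (min m (Suc j))"
      by (rule lat_le[OF d]) simp
    ultimately show ?case
      using lat_diff by fastforce
  qed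
  from this[of m] show ?thesis
    by (simp add: u_def)
qed

text \<open>Elements of positive depth normalise the image of every \<open>lat m\<close>, even when
  \<open>m\<close> is smaller than \<open>l\<close>: \<open>u \<star> y\<close> and \<open>y\<close>
  agree modulo \<open>lat m\<close>, so their quotient lies there.\<close>

lemma star_conj_in_lat:
  assumes "y \<in> lat l" "0 < l" "u \<in> lat m"
  shows "- y \<star> (u \<star> y) \<in> lat m"
  by (rule star_uminus_in_lat[OF assms(1,2)]) (rule star_left_diff[OF lat_L[OF assms(1)] assms(3)])

text \<open>With \<open>x' = x \<star> u\<close> one has
  \<open>x' \<star> y = (x \<star> y) \<star> u'\<close>, where \<open>u'\<close> is the conjugate
  of \<open>u\<close> by \<open>y\<close>. Thus right translation descends to left cosets.\<close>

lemma star_right_cong: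
  assumes x: "x \<in> lat k" "0 < k" and y: "y \<in> lat l" "0 < l" and d: "x' - x \<in> lat m"
  shows "x' \<star> y - x \<star> y \<in> lat m"
proof -
  have xL: "x \<in> L" and yL: "y \<in> L" and x'L: "x' \<in> L"
    using lat_L[OF x(1)] lat_L[OF y(1)] lat_add[of "x' - x" 0 x] lat_L[OF d] by simp_all
  define u where "u = - x \<star> x'"
  have u: "u \<in> lat m"
    unfolding u_def by (rule star_uminus_in_lat[OF x d])
  have uL: "u \<in> L"
    using lat_L[OF u] .
  have x': "x' = x \<star> u"
    unfolding u_def using xL x'L by (simp add: star_uminus_cancel)
  have "x' \<star> y = (x \<star> y) \<star> (- y \<star> (u \<star> y))"
    using xL yL uL by (simp add: x' star_assoc star_closed uminus_in_L star_uminus_cancel)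
  then show ?thesis
    using star_right_diff[OF _ star_conj_in_lat[OF y u], of "x \<star> y"] xL yL by (simp add: star_closed)
qed

text \<open>For the converse, translation by \<open>- y\<close> undoes translation by
  \<open>y\<close>, and \<open>x \<star> y\<close> still has positive depth \<open>min k l\<close>.
  The equivalence later gives injectivity of the substitution on representatives.\<close>

lemma star_right_cong_iff:
  assumes x: "x \<in> lat k" "x' \<in> lat k" "0 < k" and y: "y \<in> lat l" "0 < l"
  shows "x' \<star> y - x \<star> y \<in> lat m \<longleftrightarrow> x' - x \<in> lat m"
proof
  assume d: "x' \<star> y - x \<star> y \<in> lat m"
  have L: "x \<in> L" "x' \<in> L" "y \<in> L"
    using lat_L x y by blast+
  have "x \<star> y - x - y \<in> lat (min k l)"
    by (rule lat_le[OF star_approx[OF x(1) y(1)]]) simp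
  moreover have "x + y \<in> lat (min k l)"
    by (intro lat_add lat_le[OF x(1)] lat_le[OF y(1)]) simp_all
  ultimately have "x \<star> y \<in> lat (min k l)"
    using lat_add by fastforce
  moreover have "- y \<in> lat l"
    using y(1) by (rule lat_uminus)
  ultimately have "x' \<star> y \<star> - y - x \<star> y \<star> - y \<in> lat m"
    using x(3) y(2) by (intro star_right_cong[where k = "min k l" and l = l] d) simp_all
  then show "x' - x \<in> lat m"
    using L by (simp add: star_uminus_cancel)
qed (rule star_right_cong[OF x(1,3) y])

subsection \<open>Topology of the filtration\<close>

lemma compact_lat: "compact (lat m)"
proof -
  have "continuous_on L (mscale (\<pi> ^ m))"
  proof (rule continuous_on_iff[THEN iffD2], intro ballI allI impI)
    fix x :: "'f^'n^'n" and e :: real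
    assume "0 < e"
    moreover have "dist (mscale (\<pi> ^ m) x') (mscale (\<pi> ^ m) x) \<le> dist x' x" for x'
      using uniformizerD(4)[OF uniformizer, of m]
      by (simp add: dist_mscale val_ring_def mult_left_le_one_le)
    ultimately show "\<exists>d>0. \<forall>x'\<in>L. dist x' x < d \<longrightarrow> dist (mscale (\<pi> ^ m) x') (mscale (\<pi> ^ m) x) < e"
      by (meson le_less_trans)
  qed
  then show ?thesis
    unfolding lat_def
    by (rule compact_continuous_image) (simp add: L_eq compact_int_span finite_basis)
qed

lemma finite_lat_residues:
  obtains S where "finite S" "S \<subseteq> L" "\<And>x. x \<in> L \<Longrightarrow> \<exists>s\<in>S. x - s \<in> lat m"
proof -
  have "\<pi> ^ m \<noteq> 0"
    using uniformizerD(1)[OF uniformizer] by simp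
  then obtain S where "finite S" "S \<subseteq> int_span E"
    "\<And>x. x \<in> int_span E \<Longrightarrow> \<exists>s\<in>S. x - s \<in> mscale (\<pi> ^ m) ` int_span E"
    using finite_int_span_residues[OF finite_basis] by blast
  then show thesis
    using that[of S] unfolding lat_eq by (simp only: L_eq)
qed

text \<open>Such a set is a finite union of translates of the compact \<open>lat m\<close>. This
  makes images of cosets Borel and the image of the complement of a coset closed, using continuity
  of \<open>ex\<close> rather than of its inverse.\<close>

lemma compact_ex_saturated:
  assumes C: "C \<subseteq> L" "\<And>x x'. x \<in> C \<Longrightarrow> x' - x \<in> lat m \<Longrightarrow> x' \<in> C"
  shows "compact (ex ` C)"
proof (rule compact_continuous_image[OF continuous_on_subset[OF ex_continuous C(1)]])
  obtain S where S: "finite S" "S \<subseteq> L" "\<And>x. x \<in> L \<Longrightarrow> \<exists>s\<in>S. x - s \<in> lat m"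
    using finite_lat_residues[of m] by blast
  have "C = (\<Union>s\<in>S \<inter> C. {x + y | x y. x \<in> {s} \<and> y \<in> lat m})"
  proof (intro equalityI subsetI)
    fix x assume x: "x \<in> C"
    then obtain s where s: "s \<in> S" "x - s \<in> lat m"
      using S(3) C(1) by blast
    have "s \<in> C"
      using C(2)[OF x, of s] lat_uminus[OF s(2)] by simp
    moreover have "x = s + (x - s)"
      by simp
    ultimately show "x \<in> (\<Union>s\<in>S \<inter> C. {x + y | x y. x \<in> {s} \<and> y \<in> lat m})"
      using s by blast
  next
    fix x assume "x \<in> (\<Union>s\<in>S \<inter> C. {x + y | x y. x \<in> {s} \<and> y \<in> lat m})"
    then obtain s y where "s \<in> C" "y \<in> lat m" "x = s + y"
      by blast
    then show "x \<in> C"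
      using C(2)[of s x] by simp
  qed
  moreover have "compact (\<Union>s\<in>S \<inter> C. {x + y | x y. x \<in> {s} \<and> y \<in> lat m})"
    using S(1) by (intro compact_UN compact_mat_add compact_lat) simp_all
  ultimately show "compact C"
    by simp
qed

lemma compact_ex_lat: "compact (ex ` lat m)"
  by (rule compact_ex_saturated[where m = m]) (use lat_L lat_add in \<open>fastforce+\<close>)

lemma lat_small:
  assumes "0 < e"
  obtains m where "\<And>x. x \<in> lat m \<Longrightarrow> dist x 0 < e"
proof -
  have "bounded L"
    using compact_lat[of 0] by (simp add: compact_imp_bounded)
  then obtain b where b: "\<And>x. x \<in> L \<Longrightarrow> dist 0 x \<le> b"
    by (auto simp: bounded_any_center[where a = 0])
  have b0: "0 \<le> b"
    using b[of 0] zero_in_lat[of 0] by simp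
  obtain m where m: "absv (\<pi> ^ m) < e / (b + 1)"
    using absv_power_small[OF uniformizerD(3)[OF uniformizer], of "e / (b + 1)"] assms b0 by auto
  show thesis
  proof (rule that[of m])
    fix x assume "x \<in> lat m"
    then obtain z where z: "x = mscale (\<pi> ^ m) z" "z \<in> L"
      by (auto simp: lat_def)
    have "dist x 0 = absv (\<pi> ^ m) * dist z 0"
      using dist_mscale[of "\<pi> ^ m" z 0] by (simp add: z(1))
    also have "\<dots> \<le> absv (\<pi> ^ m) * (b + 1)"
      using b[OF z(2)] by (intro mult_left_mono) (simp_all add: dist_commute)
    also have "\<dots> < e"
      using m b0 by (simp add: pos_less_divide_eq)
    finally show "dist x 0 < e" .
  qed
qed

text \<open>Compactness of \<open>L\<close> makes local constancy uniform: a Lebesgue number of the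
  cover by sets of constancy bounds the size of a sufficiently deep \<open>lat m0\<close>.\<close>

lemma test_function_invariant:
  assumes "\<phi> \<in> test_functions L"
  obtains m0 where "\<And>m x y. m0 \<le> m \<Longrightarrow> x \<in> L \<Longrightarrow> y \<in> L \<Longrightarrow> x - y \<in> lat m \<Longrightarrow> \<phi> x = \<phi> y"
proof -
  have "\<forall>x\<in>L. \<exists>U. open U \<and> x \<in> U \<and> (\<forall>y\<in>U \<inter> L. \<phi> y = \<phi> x)"
    using assms by (simp add: test_functions_def)
  then obtain U where U: "\<And>x. x \<in> L \<Longrightarrow> open (U x)" "\<And>x. x \<in> L \<Longrightarrow> x \<in> U x"
    "\<And>x y. x \<in> L \<Longrightarrow> y \<in> U x \<Longrightarrow> y \<in> L \<Longrightarrow> \<phi> y = \<phi> x"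
    by (metis IntI)
  obtain e where e: "0 < e" "\<And>x. x \<in> L \<Longrightarrow> \<exists>G\<in>U ` L. ball x e \<subseteq> G"
  proof (rule Heine_Borel_lemma[of L "U ` L"])
    show "compact L"
      using compact_lat[of 0] by simp
    show "L \<subseteq> \<Union> (U ` L)"
      using U(2) by blast
    show "\<And>G. G \<in> U ` L \<Longrightarrow> open G"
      using U(1) by blast
  qed (use that in blast)
  obtain m0 where m0: "\<And>x. x \<in> lat m0 \<Longrightarrow> dist x 0 < e"
    using lat_small[OF e(1)] by blast
  show thesis
  proof (rule that[of m0])
    fix m x y assume A: "m0 \<le> m" "x \<in> L" "y \<in> L" "x - y \<in> lat m"
    then have "dist (x - y) 0 < e"
      using m0 lat_le by blast
    then have "y \<in> ball x e"
      using dist_mat_add_right(1)[of "x - y" y 0] by simp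
    then obtain z where "z \<in> L" "x \<in> U z" "y \<in> U z"
      using e(2)[OF A(2)] centre_in_ball[of x e] e(1) by blast
    then show "\<phi> x = \<phi> y"
      using U(3)[of z x] U(3)[of z y] A by simp
  qed
qed

lemma test_functionI:
  assumes inv: "\<And>x y. x \<in> lat l \<Longrightarrow> y \<in> lat l \<Longrightarrow> x - y \<in> lat m \<Longrightarrow> f (ex x) = f (ex y)"
    and zero: "\<And>g. g \<notin> ex ` lat l \<Longrightarrow> f g = 0"
  shows "f \<in> test_functions (ex ` lat l)"
  unfolding test_functions_def
proof (intro CollectI conjI ballI)
  show "\<exists>C. compact C \<and> C \<subseteq> ex ` lat l \<and> (\<forall>g. g \<notin> C \<longrightarrow> f g = 0)"
    using compact_ex_lat zero by blast
  fix g assume "g \<in> ex ` lat l"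
  then obtain x where x: "x \<in> lat l" "g = ex x"
    by blast
  \<comment> \<open>The points of \<open>L\<close> outside the coset of \<open>x\<close>. Their
    image is compact, hence closed, and its complement is the required neighbourhood of
    \<open>g\<close>.\<close>
  define C where "C = {y \<in> L. y - x \<notin> lat m}"
  have "compact (ex ` C)"
  proof (rule compact_ex_saturated[where m = m])
    fix y y' assume y: "y \<in> C" "y' - y \<in> lat m"
    have "y' \<in> L"
      using lat_add[of "y' - y" 0 y] lat_L[OF y(2)] y(1) by (simp add: C_def)
    moreover have "y' - x \<notin> lat m"
      using lat_diff[OF _ y(2), of "y' - x"] y(1) by (auto simp: C_def)
    ultimately show "y' \<in> C"
      by (simp add: C_def)
  qed (auto simp: C_def)
  then have "open (- ex ` C)"
    by (simp add: compact_imp_closed open_Compl)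
  moreover have "g \<in> - ex ` C"
  proof
    assume "g \<in> ex ` C"
    then obtain y where "y \<in> C" "ex y = ex x"
      using x by auto
    then have "y = x"
      using log_ex[of x] log_ex[of y] lat_L[OF x(1)] by (simp add: C_def)
    then show False
      using \<open>y \<in> C\<close> by (simp add: C_def)
  qed
  moreover have "f h = f g" if h: "h \<in> - ex ` C \<inter> ex ` lat l" for h
  proof -
    obtain y where y: "y \<in> lat l" "h = ex y" "y \<notin> C"
      using h by auto
    then have "y - x \<in> lat m"
      using lat_L by (auto simp: C_def)
    then show ?thesis
      using inv[OF y(1) x(1)] x y by simp
  qed
  ultimately show "\<exists>U. open U \<and> g \<in> U \<and> (\<forall>h\<in>U \<inter> ex ` lat l. f h = f g)"
    by blast
qed

end

section \<open>Averages over the ball group\<close>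

lemma test_functions_locally_const:
  assumes "f \<in> test_functions S" "x \<in> S"
  obtains U where "open U" "x \<in> U" "\<And>y. y \<in> U \<Longrightarrow> y \<in> S \<Longrightarrow> f y = f x"
proof -
  have "\<exists>U. open U \<and> x \<in> U \<and> (\<forall>y\<in>U \<inter> S. f y = f x)"
    using assms by (simp add: test_functions_def)
  then show thesis
    using that by blast
qed

lemma test_functions_compact_support:
  assumes "f \<in> test_functions S"
  obtains C where "compact C" "C \<subseteq> S" "\<And>x. x \<notin> C \<Longrightarrow> f x = 0"
proof -
  have "\<exists>C. compact C \<and> C \<subseteq> S \<and> (\<forall>x. x \<notin> C \<longrightarrow> f x = 0)"
    using assms by (simp add: test_functions_def)
  then show thesis
    using that by blast
qed

lemma test_functions_memI:
  assumes "\<And>x. x \<in> S \<Longrightarrow> \<exists>U. open U \<and> x \<in> U \<and> (\<forall>y\<in>U \<inter> S. f y = f x)"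
    and "compact C" "C \<subseteq> S" "\<And>x. x \<notin> C \<Longrightarrow> f x = 0"
  shows "f \<in> test_functions S"
proof -
  have "\<exists>C. compact C \<and> C \<subseteq> S \<and> (\<forall>x. x \<notin> C \<longrightarrow> f x = 0)"
    using assms(2-4) by blast
  then show ?thesis
    unfolding test_functions_def using assms(1) by simp
qed

lemma test_functions_add:
  assumes f: "f \<in> test_functions S" and g: "g \<in> test_functions S"
  shows "(\<lambda>x. f x + g x) \<in> test_functions S"
proof -
  obtain C where C: "compact C" "C \<subseteq> S" "\<And>x. x \<notin> C \<Longrightarrow> f x = 0"
    using test_functions_compact_support[OF f] by blast
  obtain D where D: "compact D" "D \<subseteq> S" "\<And>x. x \<notin> D \<Longrightarrow> g x = 0"
    using test_functions_compact_support[OF g] by blast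
  show ?thesis
  proof (rule test_functions_memI[of _ _ "C \<union> D"])
    fix x assume x: "x \<in> S"
    obtain U where U: "open U" "x \<in> U" "\<And>y. y \<in> U \<Longrightarrow> y \<in> S \<Longrightarrow> f y = f x"
      using test_functions_locally_const[OF f x] by blast
    obtain V where V: "open V" "x \<in> V" "\<And>y. y \<in> V \<Longrightarrow> y \<in> S \<Longrightarrow> g y = g x"
      using test_functions_locally_const[OF g x] by blast
    show "\<exists>U. open U \<and> x \<in> U \<and> (\<forall>y\<in>U \<inter> S. f y + g y = f x + g x)"
      by (rule exI[of _ "U \<inter> V"]) (simp add: U V open_Int)
  qed (use C D in \<open>auto intro: compact_Un\<close>)
qed

lemma test_functions_scale:
  assumes f: "f \<in> test_functions S"
  shows "(\<lambda>x. c * f x) \<in> test_functions S"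
proof -
  obtain C where C: "compact C" "C \<subseteq> S" "\<And>x. x \<notin> C \<Longrightarrow> f x = 0"
    using test_functions_compact_support[OF f] by blast
  show ?thesis
  proof (rule test_functions_memI[of _ _ C])
    fix x assume x: "x \<in> S"
    obtain U where U: "open U" "x \<in> U" "\<And>y. y \<in> U \<Longrightarrow> y \<in> S \<Longrightarrow> f y = f x"
      using test_functions_locally_const[OF f x] by blast
    show "\<exists>U. open U \<and> x \<in> U \<and> (\<forall>y\<in>U \<inter> S. c * f y = c * f x)"
      by (rule exI[of _ U]) (simp add: U)
  qed (use C in auto)
qed

lemma test_functions_zero: "(\<lambda>x. 0) \<in> test_functions S"
  by (rule test_functions_memI[of _ _ "{}"]) auto

lemma test_functions_sum:
  assumes "\<And>r. r \<in> R \<Longrightarrow> F r \<in> test_functions S"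
  shows "(\<lambda>x. \<Sum>r\<in>R. w r * F r x) \<in> test_functions S"
  using assms
  by (induction R rule: infinite_finite_induct)
    (simp_all add: test_functions_zero test_functions_add test_functions_scale)

lemma distributions_sum:
  assumes \<xi>: "\<xi> \<in> distributions S" and "finite R" and F: "\<And>r. r \<in> R \<Longrightarrow> F r \<in> test_functions S"
  shows "\<xi> (\<lambda>x. \<Sum>r\<in>R. w r * F r x) = (\<Sum>r\<in>R. w r * \<xi> (F r))"
  using \<open>finite R\<close> F
proof (induction R)
  case empty
  \<comment> \<open>The value at the zero function comes from homogeneity with scalar 0.\<close>
  have "\<xi> (\<lambda>x. 0 * 0) = 0 * \<xi> (\<lambda>x. 0)"
    using \<xi> test_functions_zero[of S] unfolding distributions_def by fastforce
  then show ?case by simp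
next
  case (insert r R)
  have "\<xi> (\<lambda>x. \<Sum>r\<in>insert r R. w r * F r x) = \<xi> (\<lambda>x. w r * F r x + (\<Sum>r\<in>R. w r * F r x))"
    using insert.hyps by simp
  also have "\<dots> = \<xi> (\<lambda>x. w r * F r x) + \<xi> (\<lambda>x. \<Sum>r\<in>R. w r * F r x)"
    using \<xi> insert.prems test_functions_sum[of R F S w] test_functions_scale[of "F r" S "w r"]
    unfolding distributions_def by simp
  also have "\<xi> (\<lambda>x. w r * F r x) = w r * \<xi> (F r)"
    using \<xi> insert.prems unfolding distributions_def by simp
  finally show ?case
    using insert by simp
qed

section \<open>Integrals over the ball group as finite sums over coset representatives\<close>

context exp_lattice
begin

text \<open>Residues of \<open>L\<close> may repeat a coset and may lie outside
  \<open>lat n\<close>, so they only bound the number of cosets. The representatives come from a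
  choice whose defining predicate depends on the coset alone, which makes them unique.\<close>

lemma lat_representatives:
  assumes "n \<le> m"
  obtains R where "finite R" "R \<subseteq> lat n" "\<And>x. x \<in> lat n \<Longrightarrow> \<exists>!r. r \<in> R \<and> x - r \<in> lat m"
proof -
  obtain S where "finite S" "S \<subseteq> L" and S': "\<And>x. x \<in> L \<Longrightarrow> \<exists>s\<in>S. x - s \<in> lat m"
    using finite_lat_residues[of m] by blast
  note S = \<open>finite S\<close> S'
  define rep where "rep x = (SOME z. z - x \<in> lat m)" for x
  have rep: "rep x - x \<in> lat m" for x
    unfolding rep_def by (rule someI[of _ x]) simp
  have rep': "x - rep x \<in> lat m" for x
    using lat_uminus[OF rep, of x] by simp
  have rep_cong: "rep x = rep y" if "x - y \<in> lat m" for x y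
  proof -
    have "z - x \<in> lat m \<longleftrightarrow> z - y \<in> lat m" for z
      using lat_add[OF _ that, of "z - x"] lat_diff[OF _ that, of "z - y"] by auto
    then show ?thesis
      by (simp add: rep_def)
  qed
  show thesis
  proof (rule that[of "rep ` lat n"])
    have "rep ` lat n \<subseteq> rep ` S"
    proof
      fix r assume "r \<in> rep ` lat n"
      then obtain x where "x \<in> lat n" "r = rep x"
        by blast
      moreover from this obtain s where "s \<in> S" "x - s \<in> lat m"
        using S(2) lat_L by blast
      ultimately show "r \<in> rep ` S"
        using rep_cong by blast
    qed
    then show "finite (rep ` lat n)"
      using S(1) finite_subset by blast
    show "rep ` lat n \<subseteq> lat n"
    proof
      fix r assume "r \<in> rep ` lat n"
      then obtain x where "x \<in> lat n" "r = rep x"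
        by blast
      then show "r \<in> lat n"
        using lat_add[OF lat_le[OF rep assms], of x x] by simp
    qed
    fix x assume x: "x \<in> lat n"
    show "\<exists>!r. r \<in> rep ` lat n \<and> x - r \<in> lat m"
    proof (rule ex1I[of _ "rep x"])
      fix r assume "r \<in> rep ` lat n \<and> x - r \<in> lat m"
      then obtain y where "r = rep y" "x - rep y \<in> lat m"
        by blast
      then show "r = rep x"
        using rep_cong[of x y] lat_add[OF _ rep, of "x - rep y" y] by simp
    qed (use x rep' in blast)
  qed
qed

text \<open>Links Haar invariance, which concerns group cosets, with additive representatives. The
  inclusion from right to left needs positive depth of \<open>r\<close>.\<close>

lemma ex_coset:
  assumes "r \<in> lat n" "0 < n"
  shows "(\<lambda>h. ex r ** h) ` ex ` lat m = ex ` {x. x - r \<in> lat m}"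
proof (intro equalityI subsetI)
  have rL: "r \<in> L"
    using lat_L[OF assms(1)] .
  fix g assume "g \<in> (\<lambda>h. ex r ** h) ` ex ` lat m"
  then obtain u where u: "u \<in> lat m" "g = ex r ** ex u"
    by blast
  then have "g = ex (r \<star> u)"
    using rL lat_L[OF u(1)] by (simp add: ex_star)
  then show "g \<in> ex ` {x. x - r \<in> lat m}"
    using star_right_diff[OF rL u(1)] by blast
next
  have rL: "r \<in> L"
    using lat_L[OF assms(1)] .
  fix g assume "g \<in> ex ` {x. x - r \<in> lat m}"
  then obtain x where x: "x - r \<in> lat m" "g = ex x"
    by blast
  have xL: "x \<in> L"
    using lat_add[of "x - r" 0 r] lat_L[OF x(1)] rL by simp
  have "- r \<star> x \<in> lat m"
    by (rule star_uminus_in_lat[OF assms x(1)])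
  moreover have "g = ex r ** ex (- r \<star> x)"
    using rL xL by (simp add: x(2) uminus_in_L star_closed star_uminus_cancel flip: ex_star)
  ultimately show "g \<in> (\<lambda>h. ex r ** h) ` ex ` lat m"
    by blast
qed

text \<open>On the ball group \<open>f\<close> is a finite combination of indicators of cosets,
  which have equal mass by invariance. Measurability and integrability of \<open>f\<close> come from
  this form.\<close>

lemma integral_ball_group:
  fixes f :: "'f^'n^'n \<Rightarrow> complex"
  assumes haar: "normalized_haar (ex ` lat n) M" and n: "0 < n" "n \<le> m"
    and R: "finite R" "R \<subseteq> lat n" "\<And>x. x \<in> lat n \<Longrightarrow> \<exists>!r. r \<in> R \<and> x - r \<in> lat m"
    and f: "\<And>x y. x \<in> lat n \<Longrightarrow> y \<in> lat n \<Longrightarrow> x - y \<in> lat m \<Longrightarrow> f (ex x) = f (ex y)"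
  shows "(\<integral>g. f g \<partial>M) = measure M (ex ` lat m) *\<^sub>R (\<Sum>r\<in>R. f (ex r))"
proof -
  define H where "H = ex ` lat n"
  have sets_M: "sets M = sets (restrict_space borel H)"
    and total: "emeasure M H = 1"
    and inv: "\<And>g A. g \<in> H \<Longrightarrow> A \<in> sets M \<Longrightarrow> emeasure M ((\<lambda>h. g ** h) ` A) = emeasure M A"
    using haar unfolding normalized_haar_def H_def[symmetric] by blast+
  have space_M: "space M = H"
    using sets_eq_imp_space_eq[OF sets_M] by (simp add: space_restrict_space)
  have coset_lat: "{x. x - r \<in> lat m} \<subseteq> lat n" if "r \<in> lat n" for r
    using lat_add[OF lat_le[OF _ n(2)] that] by fastforce
  define B where "B r = ex ` {x. x - r \<in> lat m}" for r
  have B_sets: "B r \<in> sets M" if "r \<in> lat n" for r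
  proof -
    have "compact (B r)"
      unfolding B_def
    proof (rule compact_ex_saturated[where m = m])
      show "{x. x - r \<in> lat m} \<subseteq> L"
        using coset_lat[OF that] lat_L by blast
      show "x' \<in> {x. x - r \<in> lat m}" if "x \<in> {x. x - r \<in> lat m}" "x' - x \<in> lat m" for x x'
        using lat_add[OF that(2), of "x - r"] that(1) by simp
    qed
    moreover have "B r \<subseteq> H"
      unfolding B_def H_def by (intro image_mono coset_lat that)
    then have "B r = H \<inter> B r"
      by blast
    ultimately show ?thesis
      unfolding sets_M sets_restrict_space using borel_compact by blast
  qed
  have lat_m: "ex ` lat m = B 0"
    by (simp add: B_def)
  \<comment> \<open>Left invariance for the coset of 0, translated by \<open>ex r\<close>;
    \<open>ex_coset\<close> identifies the translate.\<close>
  have B_measure: "emeasure M (B r) = emeasure M (ex ` lat m)" if "r \<in> lat n" for r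
    using inv[of "ex r" "B 0"] that B_sets[OF zero_in_lat] ex_coset[OF that n(1), of m]
    by (simp add: B_def H_def)
  have fin: "emeasure M (B r) < \<infinity>" for r
  proof -
    have "emeasure M (B r) \<le> emeasure M (space M)"
      by (rule emeasure_space)
    also have "\<dots> < \<infinity>"
      by (simp add: space_M total)
    finally show ?thesis .
  qed
  have "(\<integral>g. f g \<partial>M) = (\<integral>g. (\<Sum>r\<in>R. indicator (B r) g *\<^sub>R f (ex r)) \<partial>M)"
  proof (rule Bochner_Integration.integral_cong[OF refl])
    fix g assume "g \<in> space M"
    then obtain x where x: "x \<in> lat n" "g = ex x"
      by (auto simp: space_M H_def)
    obtain r0 where r0: "r0 \<in> R" "x - r0 \<in> lat m" "\<And>r. r \<in> R \<Longrightarrow> x - r \<in> lat m \<Longrightarrow> r = r0"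
      using R(3)[OF x(1)] by blast
    have "g \<in> B r \<longleftrightarrow> r = r0" if r: "r \<in> R" for r
    proof
      assume "g \<in> B r"
      then obtain x' where x': "x' - r \<in> lat m" "ex x = ex x'"
        by (auto simp: B_def x(2))
      have "r \<in> lat n"
        using r R(2) by blast
      from coset_lat[OF this] x'(1) have "x' \<in> lat n"
        by auto
      then have "x = x'"
        using log_ex[OF lat_L, of x' n] log_ex[OF lat_L[OF x(1)]] x'(2) by metis
      with x'(1) have "x - r \<in> lat m"
        by simp
      then show "r = r0"
        by (rule r0(3)[OF r])
    next
      assume "r = r0"
      then show "g \<in> B r"
        unfolding B_def x(2) using r0(2) by blast
    qed
    then have "(\<Sum>r\<in>R. indicator (B r) g *\<^sub>R f (ex r)) = (\<Sum>r\<in>R. if r = r0 then f (ex r) else 0)"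
      by (intro sum.cong) (auto simp: indicator_def)
    also have "\<dots> = f (ex r0)"
      using R(1) r0(1) by simp
    also have "\<dots> = f g"
      using f[OF x(1) _ r0(2)] r0(1) R(2) by (auto simp: x(2))
    finally show "f g = (\<Sum>r\<in>R. indicator (B r) g *\<^sub>R f (ex r))" ..
  qed
  also have "\<dots> = (\<Sum>r\<in>R. measure M (B r) *\<^sub>R f (ex r))"
    by (intro has_bochner_integral_integral_eq has_bochner_integral_sum
        has_bochner_integral_scaleR_left has_bochner_integral_real_indicator B_sets fin)
      (use R(2) in auto)
  also have "\<dots> = (\<Sum>r\<in>R. measure M (ex ` lat m) *\<^sub>R f (ex r))"
    using R(2) by (intro sum.cong refl arg_cong2[where f = scaleR])
      (auto simp: measure_def B_measure)
  finally show ?thesis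
    by (simp add: scaleR_sum_right)
qed

text \<open>
  For fixed \<open>y\<close> the map \<open>r \<mapsto> r \<star> y - y\<close> permutes the cosets of \<open>lat m\<close> in \<open>lat n\<close> and moves each
  of them by an element of \<open>lat (n + l)\<close>, where the character is trivial.
\<close>

lemma sum_star_eq_sum_add:
  fixes \<theta> :: "'f^'n^'n \<Rightarrow> complex"
  assumes R: "finite R" "R \<subseteq> lat n" "\<And>x. x \<in> lat n \<Longrightarrow> \<exists>!r. r \<in> R \<and> x - r \<in> lat m"
    and n: "0 < n" "n + l \<le> m" and y: "y \<in> lat l" "0 < l"
    and \<phi>: "\<And>x x'. x \<in> L \<Longrightarrow> x' \<in> L \<Longrightarrow> x - x' \<in> lat m \<Longrightarrow> \<phi> x = \<phi> x'"
    and \<theta>: "\<And>x x'. x \<in> lat n \<Longrightarrow> x' \<in> lat n \<Longrightarrow> x - x' \<in> lat (n + l) \<Longrightarrow> \<theta> x = \<theta> x'"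
  shows "(\<Sum>r\<in>R. \<theta> r * \<phi> (r \<star> y)) = (\<Sum>r\<in>R. \<theta> r * \<phi> (r + y))"
proof -
  have yL: "y \<in> L"
    using lat_L[OF y(1)] .
  have shift: "r \<star> y - y - r \<in> lat (n + l)" if "r \<in> lat n" for r
    using star_approx[OF that y(1)] by (simp add: algebra_simps)
  have shift_lat: "r \<star> y - y \<in> lat n" if "r \<in> lat n" for r
    using lat_add[OF lat_le[OF shift[OF that]] that] by simp
  \<comment> \<open>The substitution need not map \<open>R\<close> into itself, so it is followed by
    passing to the representative.\<close>
  have "\<forall>r\<in>R. \<exists>r'. r' \<in> R \<and> r \<star> y - y - r' \<in> lat m"
    using R(2,3) shift_lat by blast
  then obtain \<sigma> where \<sigma>: "\<And>r. r \<in> R \<Longrightarrow> \<sigma> r \<in> R" "\<And>r. r \<in> R \<Longrightarrow> r \<star> y - y - \<sigma> r \<in> lat m"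
    by metis
  have "inj_on \<sigma> R"
  proof (rule inj_onI)
    fix r r' assume r: "r \<in> R" "r' \<in> R" and eq: "\<sigma> r = \<sigma> r'"
    have "r \<star> y - r' \<star> y \<in> lat m"
      using lat_diff[OF \<sigma>(2)[OF r(1)] \<sigma>(2)[OF r(2)]] by (simp add: eq)
    then have "r - r' \<in> lat m"
      using star_right_cong_iff[of r' n r y l m] r R(2) n(1) y by auto
    moreover have "r - r \<in> lat m"
      by simp
    ultimately show "r = r'"
      using R(3)[of r] r R(2) by blast
  qed
  \<comment> \<open>An injective self-map of a finite set is onto, so no inverse substitution has to
    be constructed.\<close>
  moreover have "\<sigma> ` R = R"
    using endo_inj_surj[OF R(1) _ \<open>inj_on \<sigma> R\<close>] \<sigma>(1) by blast
  ultimately have "bij_betw \<sigma> R R"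
    by (simp add: bij_betw_def)
  have "\<theta> r * \<phi> (r \<star> y) = \<theta> (\<sigma> r) * \<phi> (\<sigma> r + y)" if "r \<in> R" for r
  proof -
    have r: "r \<in> lat n" "\<sigma> r \<in> lat n"
      using that \<sigma>(1) R(2) by blast+
    \<comment> \<open>Two errors meet here: the failure of additivity, in
      \<open>lat (n + l)\<close>, and the passage to a representative, in \<open>lat m\<close>. The
      second is harmless because \<open>n + l \<le> m\<close>.\<close>
    have "\<sigma> r - r \<in> lat (n + l)"
      using lat_diff[OF shift[OF r(1)] lat_le[OF \<sigma>(2)[OF that] n(2)]] by simp
    then have "\<theta> (\<sigma> r) = \<theta> r"
      by (rule \<theta>[OF r(2,1)])
    moreover have "\<phi> (r \<star> y) = \<phi> (\<sigma> r + y)"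
    proof (rule \<phi>)
      show "r \<star> y \<in> L"
        using star_closed[OF lat_L[OF r(1)] yL] .
      show "\<sigma> r + y \<in> L"
        using lat_add[of "\<sigma> r" 0 y] lat_L[OF r(2)] yL by simp
      show "r \<star> y - (\<sigma> r + y) \<in> lat m"
        using \<sigma>(2)[OF that] by (simp add: algebra_simps)
    qed
    ultimately show ?thesis by simp
  qed
  then have "(\<Sum>r\<in>R. \<theta> r * \<phi> (r \<star> y)) = (\<Sum>r\<in>R. \<theta> (\<sigma> r) * \<phi> (\<sigma> r + y))"
    by (rule sum.cong[OF refl])
  also have "\<dots> = (\<Sum>r\<in>R. \<theta> r * \<phi> (r + y))"
    by (rule sum.reindex_bij_betw[OF \<open>bij_betw \<sigma> R R\<close>])
  finally show ?thesis .
qed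

text \<open>Treats both convolutions at once, with \<open>\<Phi>\<close> built from either group
  law. Invariance in the first variable turns the integral into a finite sum; invariance in the
  second makes each summand a test function, so the sum moves inside \<open>\<xi>\<close>.\<close>

lemma integral_distribution:
  assumes haar: "normalized_haar (ex ` lat n) M" and n: "0 < n" "n \<le> m"
    and R: "finite R" "R \<subseteq> lat n" "\<And>x. x \<in> lat n \<Longrightarrow> \<exists>!r. r \<in> R \<and> x - r \<in> lat m"
    and \<xi>: "\<xi> \<in> distributions (ex ` lat l)"
    and \<eta>: "\<And>x x'. x \<in> lat n \<Longrightarrow> x' \<in> lat n \<Longrightarrow> x - x' \<in> lat m \<Longrightarrow> \<eta> (ex x) = \<eta> (ex x')"
    and \<Phi>_left: "\<And>x x' y. x \<in> lat n \<Longrightarrow> x' \<in> lat n \<Longrightarrow> x - x' \<in> lat m \<Longrightarrow> y \<in> lat l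
      \<Longrightarrow> \<Phi> (ex x) (ex y) = \<Phi> (ex x') (ex y)"
    and \<Phi>_right: "\<And>x y y'. x \<in> lat n \<Longrightarrow> y \<in> lat l \<Longrightarrow> y' \<in> lat l \<Longrightarrow> y - y' \<in> lat m
      \<Longrightarrow> \<Phi> (ex x) (ex y) = \<Phi> (ex x) (ex y')"
  shows "(\<integral>g. \<eta> g * \<xi> (cut_off (ex ` lat l) (\<Phi> g)) \<partial>M)
    = measure M (ex ` lat m) *\<^sub>R \<xi> (cut_off (ex ` lat l) (\<lambda>h. \<Sum>r\<in>R. \<eta> (ex r) * \<Phi> (ex r) h))"
proof -
  have "(\<integral>g. \<eta> g * \<xi> (cut_off (ex ` lat l) (\<Phi> g)) \<partial>M)
      = measure M (ex ` lat m) *\<^sub>R (\<Sum>r\<in>R. \<eta> (ex r) * \<xi> (cut_off (ex ` lat l) (\<Phi> (ex r))))"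
  proof (rule integral_ball_group[OF haar n R])
    fix x x' assume x: "x \<in> lat n" "x' \<in> lat n" "x - x' \<in> lat m"
    have "cut_off (ex ` lat l) (\<Phi> (ex x)) = cut_off (ex ` lat l) (\<Phi> (ex x'))"
      using \<Phi>_left[OF x] by (auto simp: cut_off_def fun_eq_iff)
    then show "\<eta> (ex x) * \<xi> (cut_off (ex ` lat l) (\<Phi> (ex x)))
        = \<eta> (ex x') * \<xi> (cut_off (ex ` lat l) (\<Phi> (ex x')))"
      using \<eta>[OF x] by simp
  qed
  also have "(\<Sum>r\<in>R. \<eta> (ex r) * \<xi> (cut_off (ex ` lat l) (\<Phi> (ex r))))
      = \<xi> (\<lambda>h. \<Sum>r\<in>R. \<eta> (ex r) * cut_off (ex ` lat l) (\<Phi> (ex r)) h)"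
  proof (rule distributions_sum[OF \<xi> R(1), symmetric])
    fix r assume "r \<in> R"
    then show "cut_off (ex ` lat l) (\<Phi> (ex r)) \<in> test_functions (ex ` lat l)"
      using R(2) \<Phi>_right by (intro test_functionI[where m = m]) (auto simp: cut_off_def)
  qed
  also have "(\<lambda>h. \<Sum>r\<in>R. \<eta> (ex r) * cut_off (ex ` lat l) (\<Phi> (ex r)) h)
      = cut_off (ex ` lat l) (\<lambda>h. \<Sum>r\<in>R. \<eta> (ex r) * \<Phi> (ex r) h)"
    by (auto simp: cut_off_def fun_eq_iff)
  finally show ?thesis .
qed

lemma integral_convolution:
  assumes haar: "normalized_haar (ex ` lat n) M" and n: "0 < n" and l: "0 < l"
    and \<xi>: "\<xi> \<in> distributions (ex ` lat l)" and \<phi>: "\<phi> \<in> test_functions L"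
    and \<eta>: "\<And>x x'. x \<in> lat n \<Longrightarrow> x' \<in> lat n \<Longrightarrow> x - x' \<in> lat (n + l) \<Longrightarrow> \<eta> (ex x) = \<eta> (ex x')"
  shows "(\<integral>g. \<eta> g * \<xi> (cut_off (ex ` lat l) (\<lambda>h. \<phi> (log (g ** h)))) \<partial>M)
    = (\<integral>g. \<eta> g * \<xi> (cut_off (ex ` lat l) (\<lambda>h. \<phi> (log g + log h))) \<partial>M)"
proof -
  obtain m0 where m0: "\<And>m x y. m0 \<le> m \<Longrightarrow> x \<in> L \<Longrightarrow> y \<in> L \<Longrightarrow> x - y \<in> lat m \<Longrightarrow> \<phi> x = \<phi> y"
    using test_function_invariant[OF \<phi>] by blast
  \<comment> \<open>\<open>m0\<close> serves the test function, \<open>n + l\<close> the character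
    and the comparison of the two sums.\<close>
  define m where "m = max m0 (n + l)"
  have m: "m0 \<le> m" "n + l \<le> m" "n \<le> m"
    by (simp_all add: m_def)
  have \<phi>_inv: "\<phi> x = \<phi> y" if "x \<in> L" "y \<in> L" "x - y \<in> lat m" for x y
    using m0[OF m(1)] that .
  have \<eta>_inv: "\<eta> (ex x) = \<eta> (ex x')" if "x \<in> lat n" "x' \<in> lat n" "x - x' \<in> lat m" for x x'
    using \<eta>[OF that(1,2) lat_le[OF that(3) m(2)]] .
  obtain R where R: "finite R" "R \<subseteq> lat n" "\<And>x. x \<in> lat n \<Longrightarrow> \<exists>!r. r \<in> R \<and> x - r \<in> lat m"
    using lat_representatives[OF m(3)] by blast
  let ?A = "ex ` lat l"
  have log_star: "log (ex x ** ex y) = x \<star> y" for x y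
    by (simp add: star_def)
  have L_add: "x + y \<in> L" if "x \<in> L" "y \<in> L" for x y
    using lat_add[of x 0 y] that by simp
  have "(\<integral>g. \<eta> g * \<xi> (cut_off ?A (\<lambda>h. \<phi> (log (g ** h)))) \<partial>M)
      = measure M (ex ` lat m) *\<^sub>R \<xi> (cut_off ?A (\<lambda>h. \<Sum>r\<in>R. \<eta> (ex r) * \<phi> (log (ex r ** h))))"
  proof (rule integral_distribution[where \<eta> = \<eta> and \<Phi> = "\<lambda>g h. \<phi> (log (g ** h))",
        OF haar n m(3) R \<xi> \<eta>_inv])
    fix x x' y assume x: "x \<in> lat n" "x' \<in> lat n" "x - x' \<in> lat m" and y: "y \<in> lat l"
    show "\<phi> (log (ex x ** ex y)) = \<phi> (log (ex x' ** ex y))"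
      unfolding log_star
      by (intro \<phi>_inv star_closed lat_L[OF x(1)] lat_L[OF x(2)] lat_L[OF y]
          star_right_cong[OF x(2) n y l x(3)])
  next
    fix x y y' assume x: "x \<in> lat n" and y: "y \<in> lat l" "y' \<in> lat l" "y - y' \<in> lat m"
    have L: "x \<in> L" "y \<in> L" "y' \<in> L"
      using lat_L x y by blast+
    define u where "u = - y' \<star> y"
    have u: "u \<in> lat m"
      unfolding u_def by (rule star_uminus_in_lat[OF y(2) l y(3)])
    have y': "y = y' \<star> u"
      unfolding u_def using L by (simp add: star_uminus_cancel)
    \<comment> \<open>A change in the right factor stays on the right, so no conjugation
      occurs.\<close>
    have "x \<star> y = (x \<star> y') \<star> u"
      using L lat_L[OF u] by (simp add: y' star_assoc)
    then have "x \<star> y - x \<star> y' \<in> lat m"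
      using star_right_diff[OF _ u, of "x \<star> y'"] L by (simp add: star_closed)
    then show "\<phi> (log (ex x ** ex y)) = \<phi> (log (ex x ** ex y'))"
      unfolding log_star by (intro \<phi>_inv star_closed L)
  qed
  also have "cut_off ?A (\<lambda>h. \<Sum>r\<in>R. \<eta> (ex r) * \<phi> (log (ex r ** h)))
      = cut_off ?A (\<lambda>h. \<Sum>r\<in>R. \<eta> (ex r) * \<phi> (log (ex r) + log h))"
  proof
    fix h
    show "cut_off ?A (\<lambda>h. \<Sum>r\<in>R. \<eta> (ex r) * \<phi> (log (ex r ** h))) h
        = cut_off ?A (\<lambda>h. \<Sum>r\<in>R. \<eta> (ex r) * \<phi> (log (ex r) + log h)) h"
    \<comment> \<open>The two sums agree only for \<open>h\<close> in the support of the
      distribution, where \<open>y\<close> has depth \<open>l\<close>; elsewhere the cut-off makes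
      both sides 0.\<close>
    proof (cases "h \<in> ?A")
      case True
      then obtain y where y: "y \<in> lat l" "h = ex y"
        by blast
      have "(\<Sum>r\<in>R. \<eta> (ex r) * \<phi> (r \<star> y)) = (\<Sum>r\<in>R. \<eta> (ex r) * \<phi> (r + y))"
        by (rule sum_star_eq_sum_add[where \<theta> = "\<lambda>x. \<eta> (ex x)", OF R n m(2) y(1) l])
          (assumption | rule \<phi>_inv \<eta>)+
      also have "\<dots> = (\<Sum>r\<in>R. \<eta> (ex r) * \<phi> (log (ex r) + y))"
        using R(2) lat_L by (intro sum.cong refl) (metis log_ex subsetD)
      finally show ?thesis
        using True lat_L[OF y(1)] by (simp add: cut_off_def log_star y(2))
    qed (simp add: cut_off_def)
  qed
  also have "measure M (ex ` lat m) *\<^sub>R \<xi> \<dots>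
      = (\<integral>g. \<eta> g * \<xi> (cut_off ?A (\<lambda>h. \<phi> (log g + log h))) \<partial>M)"
  proof (rule integral_distribution[where \<eta> = \<eta> and \<Phi> = "\<lambda>g h. \<phi> (log g + log h)",
        OF haar n m(3) R \<xi> \<eta>_inv, symmetric])
    fix x x' y assume x: "x \<in> lat n" "x' \<in> lat n" "x - x' \<in> lat m" and y: "y \<in> lat l"
    have "\<phi> (x + y) = \<phi> (x' + y)"
      using x(3) by (intro \<phi>_inv L_add lat_L[OF x(1)] lat_L[OF x(2)] lat_L[OF y]) simp
    then show "\<phi> (log (ex x) + log (ex y)) = \<phi> (log (ex x') + log (ex y))"
      using lat_L[OF x(1)] lat_L[OF x(2)] lat_L[OF y] by simp
  next
    fix x y y' assume x: "x \<in> lat n" and y: "y \<in> lat l" "y' \<in> lat l" "y - y' \<in> lat m"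
    have "\<phi> (x + y) = \<phi> (x + y')"
      using y(3) by (intro \<phi>_inv L_add lat_L[OF x] lat_L[OF y(1)] lat_L[OF y(2)]) simp
    then show "\<phi> (log (ex x) + log (ex y)) = \<phi> (log (ex x) + log (ex y'))"
      using lat_L[OF x] lat_L[OF y(1)] lat_L[OF y(2)] by simp
  qed
  finally show ?thesis .
qed

end

section \<open>Dual lattices\<close>

lemma dual_space_add: "y \<in> dual_space V \<Longrightarrow> x \<in> V \<Longrightarrow> x' \<in> V \<Longrightarrow> y (x + x') = y x + y x'"
  and dual_space_scale: "y \<in> dual_space V \<Longrightarrow> x \<in> V \<Longrightarrow> y (mscale c x) = c * y x"
  and dual_space_outside: "y \<in> dual_space V \<Longrightarrow> x \<notin> V \<Longrightarrow> y x = 0"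
  by (simp_all add: dual_space_def)

lemma dual_space_span_sum:
  assumes y: "y \<in> dual_space (mat.span E)"
  shows "finite A \<Longrightarrow> A \<subseteq> E \<Longrightarrow> y (\<Sum>e\<in>A. mscale (c e) e) = (\<Sum>e\<in>A. c e * y e)"
proof (induction A rule: finite_induct)
  case empty
  show ?case
    using dual_space_scale[OF y mat.span_zero, of 0] by simp
next
  case (insert v A)
  have v: "v \<in> mat.span E"
    using insert.prems by (intro mat.span_base) simp
  have "(\<Sum>e\<in>A. mscale (c e) e) \<in> mat.span E"
    using insert.prems by (intro mat.span_sum mat.span_scale mat.span_base) auto
  then show ?case
    using insert dual_space_add[OF y mat.span_scale[OF v]] dual_space_scale[OF y v] by simp
qed

lemma dual_space_diff:
  assumes "y \<in> dual_space V" "z \<in> dual_space V"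
  shows "y - z \<in> dual_space V"
  using assms by (simp add: dual_space_def algebra_simps)

lemma dual_lattice_diff:
  assumes "y \<in> dual_lattice V L" "z \<in> dual_lattice V L"
  shows "y - z \<in> dual_lattice V L"
  using assms by (simp add: dual_lattice_def dual_space_diff val_ring_closed)

lemma zero_in_dual_lattice: "(\<lambda>_. 0) \<in> dual_lattice V L"
  by (simp add: dual_lattice_def dual_space_def)

lemma int_span_subset_span: "int_span E \<subseteq> mat.span E"
  unfolding int_span_def by (auto intro: mat.span_sum mat.span_scale mat.span_base)

lemma mat_span_finite_sum:
  assumes "finite E" "x \<in> mat.span E"
  obtains c where "x = (\<Sum>e\<in>E. mscale (c e) e)"
  using assms mat.span_finite[OF assms(1)] by auto

text \<open>The dual basis functional, extended by zero outside the span as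
  \<open>dual_space\<close> demands. It detects integrality of a single coordinate.\<close>

lemma coordinate_dual:
  fixes E :: "('f::nonarch_local_field^'n::finite^'n) set"
  assumes E: "mat.independent E" "finite E" and e: "e \<in> E"
  obtains y where "y \<in> dual_lattice (mat.span E) (int_span E)"
    "\<And>c. y (\<Sum>b\<in>E. mscale (c b) b) = c e"
proof -
  define y where "y x = (if x \<in> mat.span E then mat.representation E x e else 0)" for x
  have y: "y \<in> dual_space (mat.span E)"
    by (simp add: dual_space_def y_def mat.span_add mat.span_scale
        mat.representation_add[OF E(1)] mat.representation_scale[OF E(1)])
  have coord: "y (\<Sum>b\<in>E. mscale (c b) b) = c e" for c
  proof -
    have "y (\<Sum>b\<in>E. mscale (c b) b) = (\<Sum>b\<in>E. c b * y b)"
      by (rule dual_space_span_sum[OF y E(2)]) simp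
    also have "\<dots> = (\<Sum>b\<in>E. if b = e then c b else 0)"
      by (intro sum.cong) (simp_all add: y_def mat.span_base mat.representation_basis[OF E(1)])
    also have "\<dots> = c e"
      using E(2) e by simp
    finally show ?thesis .
  qed
  have "y x \<in> val_ring" if x: "x \<in> int_span E" for x
  proof -
    obtain c where "x = (\<Sum>b\<in>E. mscale (c b) b)" "\<forall>b\<in>E. c b \<in> val_ring"
      using int_spanE[OF x] .
    then show ?thesis
      using coord e by simp
  qed
  then have "y \<in> dual_lattice (mat.span E) (int_span E)"
    using y by (simp add: dual_lattice_def)
  then show thesis
    using that coord by blast
qed

text \<open>The differences within a coset of an additive subgroup form that subgroup; taking the
  zero functional as second point reaches every element.\<close>

lemma ball_lattice_eq:
  "ball_lattice ((\<lambda>y. a + y) ` fscale c ` dual_lattice V L) = fscale c ` dual_lattice V L"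
proof (intro equalityI subsetI)
  fix w assume "w \<in> ball_lattice ((\<lambda>y. a + y) ` fscale c ` dual_lattice V L)"
  then obtain y z where "y \<in> dual_lattice V L" "z \<in> dual_lattice V L"
    "w = (a + fscale c y) - (a + fscale c z)"
    unfolding ball_lattice_def by auto
  then have "w = fscale c (y - z)" "y - z \<in> dual_lattice V L"
    by (simp_all add: dual_lattice_diff fscale_def fun_eq_iff algebra_simps)
  then show "w \<in> fscale c ` dual_lattice V L"
    by blast
next
  fix w assume "w \<in> fscale c ` dual_lattice V L"
  then have "a + w \<in> (\<lambda>y. a + y) ` fscale c ` dual_lattice V L"
    by blast
  moreover have "a + fscale c (\<lambda>_. 0) \<in> (\<lambda>y. a + y) ` fscale c ` dual_lattice V L"
    using zero_in_dual_lattice by blast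
  moreover have "w = (a + w) - (a + fscale c (\<lambda>_. 0))"
    by (simp add: fscale_def fun_eq_iff)
  ultimately show "w \<in> ball_lattice ((\<lambda>y. a + y) ` fscale c ` dual_lattice V L)"
    unfolding ball_lattice_def by blast
qed

text \<open>Biduality for a scaled lattice: the dual basis functionals force each coordinate to be
  divisible by \<open>c\<close>, and the converse is linearity.\<close>

lemma predual_lattice_scaled:
  fixes E :: "('f::nonarch_local_field^'n::finite^'n) set"
  assumes E: "mat.independent E" "finite E" and c: "c \<noteq> 0"
  shows "predual_lattice (mat.span E) (fscale (inverse c) ` dual_lattice (mat.span E) (int_span E))
    = mscale c ` int_span E"
proof (intro equalityI subsetI)
  fix x
  assume x: "x \<in> predual_lattice (mat.span E) (fscale (inverse c) ` dual_lattice (mat.span E) (int_span E))"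
  then obtain b where b: "x = (\<Sum>e\<in>E. mscale (b e) e)"
    using mat_span_finite_sum[OF E(2)] unfolding predual_lattice_def by blast
  have "inverse c * b e \<in> val_ring" if e: "e \<in> E" for e
  proof -
    obtain y where "y \<in> dual_lattice (mat.span E) (int_span E)"
      "\<And>c. y (\<Sum>b\<in>E. mscale (c b) b) = c e"
      using coordinate_dual[OF E e] by blast
    then show ?thesis
      using x unfolding predual_lattice_def by (auto simp: fscale_def b)
  qed
  then have "(\<Sum>e\<in>E. mscale (inverse c * b e) e) \<in> int_span E"
    by (intro int_spanI[OF refl])
  moreover have "x = mscale c (\<Sum>e\<in>E. mscale (inverse c * b e) e)"
    using c by (simp add: b mat.scale_sum_right flip: mult.assoc)
  ultimately show "x \<in> mscale c ` int_span E"
    by blast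
next
  fix x assume "x \<in> mscale c ` int_span E"
  then obtain z where z: "z \<in> int_span E" "x = mscale c z"
    by blast
  have zV: "z \<in> mat.span E"
    using z(1) int_span_subset_span by blast
  then have "x \<in> mat.span E"
    by (simp add: z(2) mat.span_scale)
  moreover have "fscale (inverse c) y x \<in> val_ring"
    if "y \<in> dual_lattice (mat.span E) (int_span E)" for y
    using that z(1) c dual_space_scale[OF _ zV, of y c]
    by (simp add: dual_lattice_def fscale_def z(2) flip: mult.assoc)
  ultimately show "x \<in> predual_lattice (mat.span E) (fscale (inverse c) ` dual_lattice (mat.span E) (int_span E))"
    unfolding predual_lattice_def by blast
qed

text \<open>\<open>LEAST\<close> over the reals is a genuine minimum only when it is attained, hence
  the explicit witness \<open>\<alpha>\<close> next to the lower bound.\<close>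

lemma dual_abs_eq:
  assumes y: "y \<in> dual_lattice V L" and a: "a = fscale \<alpha> y"
    and le: "\<And>\<beta> z. z \<in> dual_lattice V L \<Longrightarrow> a = fscale \<beta> z \<Longrightarrow> absv \<alpha> \<le> absv \<beta>"
  shows "dual_abs V L a = absv \<alpha>"
  unfolding dual_abs_def
proof (rule Least_equality)
  show "\<exists>\<alpha>'. absv \<alpha> = absv \<alpha>' \<and> a \<in> fscale \<alpha>' ` dual_lattice V L"
    using y a by blast
  show "\<exists>\<beta>. r = absv \<beta> \<and> a \<in> fscale \<beta> ` dual_lattice V L \<Longrightarrow> absv \<alpha> \<le> r" for r
    using le by blast
qed

text \<open>
  The minimum defining \<open>dual_abs\<close> is attained at the largest value of the functional on a basis.
\<close>

lemma absv_le_dual_abs: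
  fixes E :: "('f::nonarch_local_field^'n::finite^'n) set"
  assumes E: "finite E" and a: "a \<in> dual_space (mat.span E)" and x: "x \<in> int_span E"
  shows "absv (a x) \<le> dual_abs (mat.span E) (int_span E) a"
proof -
  obtain \<alpha> y where y: "y \<in> dual_lattice (mat.span E) (int_span E)" "a = fscale \<alpha> y"
    "dual_abs (mat.span E) (int_span E) a = absv \<alpha>"
  proof (cases "\<exists>e\<in>E. a e \<noteq> 0")
    case True
    then have "E \<noteq> {}" by blast
    then obtain e0 where e0: "e0 \<in> E" "\<And>e. e \<in> E \<Longrightarrow> absv (a e) \<le> absv (a e0)"
      using Max_in[of "(\<lambda>e. absv (a e)) ` E"] Max_ge[of "(\<lambda>e. absv (a e)) ` E"] E by fastforce
    obtain e1 where e1: "e1 \<in> E" "0 < absv (a e1)"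
      using True by auto
    have pos: "0 < absv (a e0)"
      using e1(2) e0(2)[OF e1(1)] by linarith
    then have nz: "a e0 \<noteq> 0" by simp
    define y where "y = fscale (inverse (a e0)) a"
    have "y \<in> dual_space (mat.span E)"
      using a by (simp add: dual_space_def y_def fscale_def algebra_simps)
    moreover have "y x \<in> val_ring" if x: "x \<in> int_span E" for x
    proof -
      obtain c where c: "x = (\<Sum>e\<in>E. mscale (c e) e)" "\<forall>e\<in>E. c e \<in> val_ring"
        using int_spanE[OF x] .
      have "absv (\<Sum>e\<in>E. c e * a e) \<le> absv (a e0)"
      proof (rule absv_sum_le)
        fix e assume e: "e \<in> E"
        have "absv (c e) * absv (a e) \<le> 1 * absv (a e0)"
          using c(2) e e0(2)[OF e] by (intro mult_mono) (simp_all add: val_ring_def)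
        then show "absv (c e * a e) \<le> absv (a e0)"
          by (simp add: absv_mult)
      qed simp
      then have "inverse (absv (a e0)) * absv (\<Sum>e\<in>E. c e * a e) \<le> inverse (absv (a e0)) * absv (a e0)"
        by (rule mult_left_mono) simp
      then show ?thesis
        using nz dual_space_span_sum[OF a E subset_refl, of c]
        by (simp add: val_ring_def y_def fscale_def c(1) absv_mult absv_inverse)
    qed
    ultimately have y: "y \<in> dual_lattice (mat.span E) (int_span E)"
      by (simp add: dual_lattice_def)
    have ay: "a = fscale (a e0) y"
      using nz by (simp add: fun_eq_iff y_def fscale_def)
    have "dual_abs (mat.span E) (int_span E) a = absv (a e0)"
    proof (rule dual_abs_eq[OF y ay])
      \<comment> \<open>Evaluation at \<open>e0\<close> bounds every admissible scalar from below,
        since \<open>z e0\<close> is integral.\<close>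
      fix \<beta> z assume z: "z \<in> dual_lattice (mat.span E) (int_span E)" "a = fscale \<beta> z"
      have "absv (z e0) \<le> 1"
        using z(1) int_span_base[OF E e0(1)] by (simp add: dual_lattice_def val_ring_def)
      then have "absv \<beta> * absv (z e0) \<le> absv \<beta>"
        by (simp add: mult_left_le)
      then show "absv (a e0) \<le> absv \<beta>"
        by (simp add: z(2) fscale_def absv_mult)
    qed
    with y ay show ?thesis
      by (rule that)
  next
    \<comment> \<open>A functional vanishing on the generators is zero and cannot be normalised by a
      value; the minimum is then attained at the scalar 0.\<close>
    case False
    have "a v = 0" for v
    proof (cases "v \<in> mat.span E")
      case True
      then obtain c where "v = (\<Sum>e\<in>E. mscale (c e) e)"
        using mat_span_finite_sum[OF E] by blast
      then show ?thesis
        using False dual_space_span_sum[OF a E subset_refl, of c] by simp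
    qed (rule dual_space_outside[OF a])
    then have a0: "a = fscale 0 (\<lambda>_. 0)"
      by (simp add: fun_eq_iff fscale_def)
    have "dual_abs (mat.span E) (int_span E) a = absv (0 :: 'f)"
      by (rule dual_abs_eq[OF zero_in_dual_lattice a0]) simp
    with zero_in_dual_lattice a0 show ?thesis
      by (rule that)
  qed
  have "absv (y x) \<le> 1"
    using y(1) x by (simp add: dual_lattice_def val_ring_def)
  then show ?thesis
    unfolding y(3) by (simp add: y(2) fscale_def absv_mult mult_left_le)
qed

text \<open>Independence of the centre that \<open>SOME\<close> picks: another centre differs from
  \<open>a\<close> by \<open>inverse c\<close> times an integral functional, which is integral on
  \<open>mscale c\<close> applied to \<open>L\<close>, and there \<open>\<psi>\<close> is
  trivial.\<close>

lemma ball_char_ex: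
  assumes "x \<in> mscale c ` L" "mscale c ` L \<subseteq> L" "inj_on ex L" "c \<noteq> 0" "L \<subseteq> V"
    and \<psi>: "additive_character \<psi>" "\<forall>x\<in>val_ring. \<psi> x = 1"
    and B: "B = (\<lambda>y. a + y) ` fscale (inverse c) ` dual_lattice V L"
  shows "ball_char \<psi> L ex B (ex x) = \<psi> (a x)"
proof -
  obtain z where z: "z \<in> L" "x = mscale c z"
    using assms(1) by blast
  have "x \<in> L"
    using assms(1,2) by blast
  have "a + fscale (inverse c) (\<lambda>_. 0) \<in> B"
    unfolding B using zero_in_dual_lattice by blast
  then have "(SOME a. a \<in> B) \<in> B"
    by (rule someI[where P = "\<lambda>a. a \<in> B"])
  then obtain y where y: "y \<in> dual_lattice V L" "(SOME a. a \<in> B) = a + fscale (inverse c) y"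
    unfolding B by blast
  have "fscale (inverse c) y x = y z"
    using dual_space_scale[of y V z c] y(1) z assms(4,5) by (auto simp: fscale_def dual_lattice_def)
  moreover have "\<psi> (y z) = 1"
    using y(1) z(1) \<psi>(2) by (simp add: dual_lattice_def)
  ultimately have "\<psi> ((SOME a. a \<in> B) x) = \<psi> (a x)"
    using \<psi>(1) by (simp add: y(2) additive_character_def)
  then show ?thesis
    using \<open>x \<in> L\<close> assms(3) by (simp add: ball_char_def)
qed

lemma cut_off_in: "x \<in> A \<Longrightarrow> cut_off A f x = f x"
  by (simp add: cut_off_def)

theorem proposition5p3p4:
  fixes P :: "('f::{nonarch_local_field, field_char_0}, 'n::finite) mat_poly set"
    and \<pi> :: 'f and q :: real and \<psi> :: "'f \<Rightarrow> complex"
    and \<gg> L K :: "('f^'n^'n) set" and ex :: "'f^'n^'n \<Rightarrow> 'f^'n^'n"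
    and a :: "'f^'n^'n \<Rightarrow> 'f" and B :: "('f^'n^'n \<Rightarrow> 'f) set"
    and M :: "('f^'n^'n) measure" and \<xi> :: "('f^'n^'n \<Rightarrow> complex) \<Rightarrow> complex"
    and n l :: nat
  assumes "uniformizer \<pi>" and "q = inverse (absv \<pi>)"
    and "additive_character \<psi>"
    and "\<forall>x\<in>val_ring. \<psi> x = 1"
    and "\<exists>x\<in>val_ring. \<psi> (inverse \<pi> * x) \<noteq> 1"
    and "reductive_group P" and "\<gg> = lie_algebra P"
    and "exp_datum P \<pi> L K ex"
    and "n > 0" and "l > 0"
    and "a \<in> dual_space \<gg>"
    and "B = (\<lambda>y. a + y) ` fscale (\<pi> powi (- int n)) ` dual_lattice \<gg> L"
    and "admissible_ball \<psi> \<gg> L ex B"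
    and "dual_abs \<gg> L a = q ^ (n + l)"
    and "normalized_haar (ball_group \<gg> ex B) M"
    and "\<xi> \<in> distributions (ex ` mscale (\<pi> ^ l) ` L)"
  shows "\<forall>\<phi>\<in>test_functions L.
     exp_transport L K ex
       (convolution (**) (ball_measure \<psi> L ex M B)
          (extend_distribution (ex ` mscale (\<pi> ^ l) ` L) \<xi>)) \<phi>
     = convolution (+) (exp_transport L K ex (ball_measure \<psi> L ex M B))
         (exp_transport L K ex (extend_distribution (ex ` mscale (\<pi> ^ l) ` L) \<xi>)) \<phi>"
proof
  note uniformizer = assms(1) and q = assms(2) and \<psi> = assms(3,4) and datum = assms(8)
  have lattice: "is_lattice mscale \<gg> L" and bij: "bij_betw ex L K"
    and analytic: "analytic_map_on L ex" and K: "subgroup K GL"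
    and line: "\<forall>x\<in>L. \<forall>s\<in>val_ring. \<forall>t\<in>val_ring.
        ex (mscale s x + mscale t x) = ex (mscale s x) ** ex (mscale t x)"
    and product: "\<forall>(m::nat) (n::nat). \<forall>x\<in>mscale (\<pi> ^ m) ` L. \<forall>y\<in>mscale (\<pi> ^ n) ` L.
        inv_into L ex (ex x ** ex y) - x - y \<in> mscale (\<pi> ^ (m + n)) ` L"
    using datum unfolding exp_datum_def analytic_diffeomorphism_def assms(7)[symmetric]
    by blast+
  obtain E where E: "finite E" "mat.independent E" "mat.span E = \<gg>" "L = int_span E"
    using lattice_int_span[OF lattice] .
  interpret exp_lattice \<pi> E L K ex
    by (rule exp_lattice.intro)
      (use uniformizer E bij K line product continuous_on_analytic[OF analytic] in blast)+
  define c where "c = \<pi> ^ n"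
  have c: "c \<noteq> 0"
    using uniformizerD(1)[OF uniformizer] by (simp add: c_def)
  have B: "B = (\<lambda>y. a + y) ` fscale (inverse c) ` dual_lattice \<gg> L"
    using assms(12) by (simp add: c_def power_int_minus)
  have lat_n: "lat n = mscale c ` L"
    by (simp add: lat_def c_def)
  have "ball_lattice B = fscale (inverse c) ` dual_lattice \<gg> L"
    unfolding B by (rule ball_lattice_eq)
  then have "predual_lattice \<gg> (ball_lattice B) = lat n"
    using predual_lattice_scaled[OF E(2,1) c] unfolding E(3) lat_n by (simp only: E(4))
  then have group: "ball_group \<gg> ex B = ex ` lat n"
    by (simp add: ball_group_def)
  then have haar: "normalized_haar (ex ` lat n) M"
    using assms(15) by simp
  have L_sub: "L \<subseteq> \<gg>"
    using int_span_subset_span[of E] by (simp only: E(3,4))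
  define \<eta> where "\<eta> = ball_char \<psi> L ex B"
  have \<eta>: "\<eta> (ex x) = \<psi> (a x)" if "x \<in> lat n" for x
    unfolding \<eta>_def
  proof (rule ball_char_ex[OF _ _ _ c L_sub \<psi> B])
    show "mscale c ` L \<subseteq> L"
      using lat_mono[of 0 n] by (simp add: lat_n)
  qed (use that bij lat_n in \<open>auto simp: bij_betw_def\<close>)
  have \<psi>_deep: "\<psi> (a x) = 1" if x: "x \<in> lat (n + l)" for x
  proof -
    obtain z where z: "z \<in> L" "x = mscale (\<pi> ^ (n + l)) z"
      using x by (auto simp: lat_def)
    have "absv (a z) \<le> q ^ (n + l)"
      using absv_le_dual_abs[OF E(1), of a z] assms(11,14) z(1) by (simp add: E(3,4))
    then have "absv (\<pi> ^ (n + l)) * absv (a z) \<le> absv (\<pi> ^ (n + l)) * q ^ (n + l)"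
      by (rule mult_left_mono) simp
    \<comment> \<open>The depth \<open>n + l\<close> exactly compensates the size
      \<open>q ^ (n + l)\<close> of the functional, so \<open>a x\<close> is integral.\<close>
    also have "\<dots> = 1"
      using uniformizerD(1)[OF uniformizer] by (simp add: q absv_power flip: power_mult_distrib)
    finally have "a x \<in> val_ring"
      using z L_sub dual_space_scale[OF assms(11), of z] by (auto simp: val_ring_def absv_mult)
    then show ?thesis
      using \<psi>(2) by blast
  qed
  have \<eta>_inv: "\<eta> (ex x) = \<eta> (ex x')" if x: "x \<in> lat n" "x' \<in> lat n" "x - x' \<in> lat (n + l)" for x x'
  proof -
    have "a ((x - x') + x') = a (x - x') + a x'"
      using x lat_L L_sub by (intro dual_space_add[OF assms(11)]) blast+
    then have "\<psi> (a x) = \<psi> (a (x - x')) * \<psi> (a x')"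
      using \<psi>(1) by (simp add: additive_character_def)
    then show ?thesis
      using \<psi>_deep[OF x(3)] by (simp add: \<eta> x)
  qed
  have \<xi>: "\<xi> \<in> distributions (ex ` lat l)"
    using assms(16) by (simp add: lat_def)
  have space_M: "space M = ex ` lat n"
    using haar sets_eq_imp_space_eq[of M "restrict_space borel (ex ` lat n)"]
    by (simp add: normalized_haar_def space_restrict_space)
  have in_K: "ex x \<in> K" if "x \<in> lat k" for x k
    using ex_in_K[OF lat_L[OF that]] .
  fix \<phi> :: "'f^'n^'n \<Rightarrow> complex"
  assume \<phi>: "\<phi> \<in> test_functions L"
  let ?A = "ex ` lat l"
  have "exp_transport L K ex (convolution (**) (ball_measure \<psi> L ex M B) (extend_distribution ?A \<xi>)) \<phi>
      = (\<integral>g. \<eta> g * \<xi> (cut_off ?A (\<lambda>h. cut_off K (\<lambda>g. \<phi> (log g)) (g ** h))) \<partial>M)"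
    by (simp add: exp_transport_def convolution_def ball_measure_def extend_distribution_def \<eta>_def)
  \<comment> \<open>The cut-off to \<open>K\<close> is invisible: the measure lives on a subset of
    \<open>K\<close>, so does \<open>?A\<close>, and \<open>K\<close> is closed under
    products.\<close>
  also have "\<dots> = (\<integral>g. \<eta> g * \<xi> (cut_off ?A (\<lambda>h. \<phi> (log (g ** h)))) \<partial>M)"
  proof (rule Bochner_Integration.integral_cong[OF refl])
    fix g assume "g \<in> space M"
    then have "g \<in> K"
      using in_K by (auto simp: space_M)
    then have "cut_off ?A (\<lambda>h. cut_off K (\<lambda>g. \<phi> (log g)) (g ** h)) = cut_off ?A (\<lambda>h. \<phi> (log (g ** h)))"
      using in_K by (auto simp: cut_off_def fun_eq_iff K_mult)
    then show "\<eta> g * \<xi> (cut_off ?A (\<lambda>h. cut_off K (\<lambda>g. \<phi> (log g)) (g ** h)))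
        = \<eta> g * \<xi> (cut_off ?A (\<lambda>h. \<phi> (log (g ** h))))"
      by simp
  qed
  also have "\<dots> = (\<integral>g. \<eta> g * \<xi> (cut_off ?A (\<lambda>h. \<phi> (log g + log h))) \<partial>M)"
    by (rule integral_convolution[where \<eta> = \<eta>, OF haar assms(9,10) \<xi> \<phi> \<eta>_inv])
  \<comment> \<open>Transporting the two factors separately puts a cut-off to \<open>K\<close> on
    each variable; both are vacuous on the supports.\<close>
  also have "\<dots> = (\<integral>g. \<eta> g * cut_off K (\<lambda>g. \<xi> (cut_off ?A (cut_off K (\<lambda>h. \<phi> (log g + log h))))) g \<partial>M)"
  proof (rule Bochner_Integration.integral_cong[OF refl])
    fix g assume "g \<in> space M"
    then have "g \<in> K"
      using in_K by (auto simp: space_M)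
    moreover have "cut_off ?A (cut_off K (\<lambda>h. \<phi> (log g + log h))) = cut_off ?A (\<lambda>h. \<phi> (log g + log h))"
      using in_K by (auto simp: cut_off_def fun_eq_iff)
    ultimately show "\<eta> g * \<xi> (cut_off ?A (\<lambda>h. \<phi> (log g + log h)))
        = \<eta> g * cut_off K (\<lambda>g. \<xi> (cut_off ?A (cut_off K (\<lambda>h. \<phi> (log g + log h))))) g"
      by (simp add: cut_off_in)
  qed
  also have "\<dots> = convolution (+) (exp_transport L K ex (ball_measure \<psi> L ex M B))
         (exp_transport L K ex (extend_distribution ?A \<xi>)) \<phi>"
    by (simp add: exp_transport_def convolution_def ball_measure_def extend_distribution_def \<eta>_def)
  finally show "exp_transport L K ex
       (convolution (**) (ball_measure \<psi> L ex M B)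
          (extend_distribution (ex ` mscale (\<pi> ^ l) ` L) \<xi>)) \<phi>
     = convolution (+) (exp_transport L K ex (ball_measure \<psi> L ex M B))
         (exp_transport L K ex (extend_distribution (ex ` mscale (\<pi> ^ l) ` L) \<xi>)) \<phi>"
    unfolding lat_def .
qed

end
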